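(* Let the data be the $2n$ points $$x_{1,i}=\begin{bmatrix}-\frac{\Delta}{2}\\ \frac{i-1}{n-1}\end{bmatrix},\qquad x_{2,i}=\begin{bmatrix}\frac{\Delta}{2}\\ \frac{i-1}{n-1}\end{bmatrix},\qquad 1\le i\le n,$$ on two parallel lines with separation $\Delta>0$. Let the weights be given by the heat kernel $w(x,y)=e^{-\|x-y\|^2/(2\sigma^2)}$ with bandwidth $\sigma>0$ given by $$\sigma^2=\frac{\gamma}{(n-1)^2\log(\frac{n}{\pi})},\qquad \gamma>0.$$ Assume the separation $\Delta$ satisfies $$\Delta\ \ge\ \frac{1}{n-1}\sqrt{1+\frac{6\gamma\log n}{\log(\frac{n}{\pi})}}.$$ Then the SDP relaxation of spectral clustering (the algorithm described in the context, comprising RatioCut-SDP and NCut-SDP, with $k=2$) recovers the two underlying clusters $\{x_{1,i}\}_{i=1}^n$ and $\{x_{2,i}\}_{i=1}^n$ exactly.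
   Context: Let $N=2n$, let $W\in\mathbb{R}^{N\times N}$ be the symmetric matrix of all pairwise weights $w(x,y)$ of the data points, $1_N$ the all-ones vector, $D=\operatorname{diag}(W1_N)$, $L=D-W$ the unnormalized graph Laplacian, and $L_{\mathrm{sym}}=I_N-D^{-1/2}WD^{-1/2}$ the normalized one. The SDP relaxation of spectral clustering with $k$ clusters is an algorithm with two versions, which compute $\widehat Z$ by solving, over symmetric $Z\in\mathbb{R}^{N\times N}$, respectively: (a) RatioCut-SDP: minimize $\langle L,Z\rangle$ subject to $Z\succeq0$, $Z\ge0$ entrywise, $\operatorname{Tr}(Z)=k$, $Z1_N=1_N$; (b) NCut-SDP: minimize $\langle L_{\mathrm{sym}},Z\rangle$ subject to $Z\succeq0$, $Z\ge0$ entrywise, $\operatorname{Tr}(Z)=k$, $ZD^{1/2}1_N=D^{1/2}1_N$; and then read off the clustering from $\widehat Z$. Here $\langle A,Z\rangle=\operatorname{Tr}(A^\top Z)$. For a partition $\Gamma_1,\dots,\Gamma_k$ of the points with indicator vectors $1_{\Gamma_a}$, exact recovery means that the unique global minimizer is the partition matrix: $\sum_{a=1}^k\frac{1}{|\Gamma_a|}1_{\Gamma_a}1_{\Gamma_a}^\top$ for RatioCut-SDP, and $\sum_{a=1}^k\frac{1}{1_{\Gamma_a}^\top D1_{\Gamma_a}}D^{1/2}1_{\Gamma_a}1_{\Gamma_a}^\top D^{1/2}$ for NCut-SDP. *)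

theory Defs
  imports
    "HOL-Library.Indicator_Function"
    "HOL-Analysis.Product_Vector"
    "Jordan_Normal_Form.Matrix"
begin

section \<open>Semidefinite relaxations of spectral clustering\<close>

text \<open>Throughout, a data set of \<open>N\<close> points is indexed by \<open>{0..<N}\<close>, and matrices over the data
  are \<open>N \<times> N\<close> matrices of \<^theory>\<open>Jordan_Normal_Form.Matrix\<close>; \<open>N\<close> is recovered from the weight
  matrix \<open>W\<close> as \<open>dim_row W\<close>.\<close>

definition weight_mat :: "nat \<Rightarrow> ('a \<Rightarrow> 'a \<Rightarrow> real) \<Rightarrow> (nat \<Rightarrow> 'a) \<Rightarrow> real mat" where
  "weight_mat N w x = mat N N (\<lambda>(p, q). w (x p) (x q))"

definition ones_vec :: "nat \<Rightarrow> real vec" where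
  "ones_vec N = vec N (\<lambda>_. 1)"

definition indicator_vec :: "nat \<Rightarrow> nat set \<Rightarrow> real vec" where
  "indicator_vec N S = vec N (indicator S)"

definition degree_vec :: "real mat \<Rightarrow> real vec" where
  "degree_vec W = W *\<^sub>v ones_vec (dim_row W)"

definition degree_mat :: "real mat \<Rightarrow> real mat" where
  "degree_mat W = mat_diag (dim_row W) (\<lambda>p. degree_vec W $ p)"

text \<open>The next two are \<open>D\<^sup>1\<^sup>/\<^sup>2\<close> and \<open>D\<^sup>-\<^sup>1\<^sup>/\<^sup>2\<close>, with that meaning when all degrees are positive.\<close>

definition degree_sqrt_mat :: "real mat \<Rightarrow> real mat" where
  "degree_sqrt_mat W = mat_diag (dim_row W) (\<lambda>p. sqrt (degree_vec W $ p))"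

definition degree_inv_sqrt_mat :: "real mat \<Rightarrow> real mat" where
  "degree_inv_sqrt_mat W = mat_diag (dim_row W) (\<lambda>p. 1 / sqrt (degree_vec W $ p))"

definition laplacian :: "real mat \<Rightarrow> real mat" where
  "laplacian W = degree_mat W - W"

definition sym_laplacian :: "real mat \<Rightarrow> real mat" where
  "sym_laplacian W =
     1\<^sub>m (dim_row W) - degree_inv_sqrt_mat W * W * degree_inv_sqrt_mat W"

definition mat_trace :: "real mat \<Rightarrow> real" where
  "mat_trace A = (\<Sum>p<dim_row A. A $$ (p, p))"

definition frob_inner :: "real mat \<Rightarrow> real mat \<Rightarrow> real" where
  "frob_inner A Z = mat_trace (transpose_mat A * Z)"

definition sym_psd :: "nat \<Rightarrow> real mat \<Rightarrow> bool" where
  "sym_psd N Z \<longleftrightarrow> Z \<in> carrier_mat N N \<and> transpose_mat Z = Z \<and>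
     (\<forall>v \<in> carrier_vec N. 0 \<le> scalar_prod v (Z *\<^sub>v v))"

definition ratiocut_feasible :: "real mat \<Rightarrow> nat \<Rightarrow> real mat set" where
  "ratiocut_feasible W k = {Z. sym_psd (dim_row W) Z \<and>
     (\<forall>p < dim_row W. \<forall>q < dim_row W. 0 \<le> Z $$ (p, q)) \<and>
     mat_trace Z = real k \<and>
     Z *\<^sub>v ones_vec (dim_row W) = ones_vec (dim_row W)}"

definition ncut_feasible :: "real mat \<Rightarrow> nat \<Rightarrow> real mat set" where
  "ncut_feasible W k = {Z. sym_psd (dim_row W) Z \<and>
     (\<forall>p < dim_row W. \<forall>q < dim_row W. 0 \<le> Z $$ (p, q)) \<and>
     mat_trace Z = real k \<and>
     Z *\<^sub>v (degree_sqrt_mat W *\<^sub>v ones_vec (dim_row W))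
       = degree_sqrt_mat W *\<^sub>v ones_vec (dim_row W)}"

text \<open>Clusters are sets of indices \<open>\<Gamma> 1, \<dots>, \<Gamma> k\<close>. The partition matrices are sums of scaled
  matrices \<open>u u\<^sup>T\<close>, written out entrywise as \<^const>\<open>sum\<close> is not available at type
  \<^typ>\<open>real mat\<close>.\<close>

definition ratiocut_partition_mat :: "real mat \<Rightarrow> nat \<Rightarrow> (nat \<Rightarrow> nat set) \<Rightarrow> real mat" where
  "ratiocut_partition_mat W k \<Gamma> =
     (let N = dim_row W; u = (\<lambda>a. indicator_vec N (\<Gamma> a))
      in mat N N (\<lambda>(p, q). \<Sum>a = 1..k. 1 / real (card (\<Gamma> a)) * (u a $ p * u a $ q)))"

definition ncut_partition_mat :: "real mat \<Rightarrow> nat \<Rightarrow> (nat \<Rightarrow> nat set) \<Rightarrow> real mat" where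
  "ncut_partition_mat W k \<Gamma> =
     (let N = dim_row W; e = (\<lambda>a. indicator_vec N (\<Gamma> a));
          u = (\<lambda>a. degree_sqrt_mat W *\<^sub>v e a)
      in mat N N (\<lambda>(p, q). \<Sum>a = 1..k.
           1 / scalar_prod (e a) (degree_mat W *\<^sub>v e a) * (u a $ p * u a $ q)))"

definition ratiocut_sdp_exact_recovery :: "real mat \<Rightarrow> nat \<Rightarrow> (nat \<Rightarrow> nat set) \<Rightarrow> bool" where
  "ratiocut_sdp_exact_recovery W k \<Gamma> \<longleftrightarrow>
     {Z. is_arg_min (frob_inner (laplacian W)) (\<lambda>Z. Z \<in> ratiocut_feasible W k) Z}
       = {ratiocut_partition_mat W k \<Gamma>}"

definition ncut_sdp_exact_recovery :: "real mat \<Rightarrow> nat \<Rightarrow> (nat \<Rightarrow> nat set) \<Rightarrow> bool" where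
  "ncut_sdp_exact_recovery W k \<Gamma> \<longleftrightarrow>
     {Z. is_arg_min (frob_inner (sym_laplacian W)) (\<lambda>Z. Z \<in> ncut_feasible W k) Z}
       = {ncut_partition_mat W k \<Gamma>}"

section \<open>Two parallel lines\<close>

definition heat_kernel :: "real \<Rightarrow> 'a::real_normed_vector \<Rightarrow> 'a \<Rightarrow> real" where
  "heat_kernel \<sigma> x y = exp (- (norm (x - y))\<^sup>2 / (2 * \<sigma>\<^sup>2))"

text \<open>The point \<open>x\<^bsub>a,i\<^esub>\<close> for \<open>a \<in> {1, 2}\<close> and \<open>1 \<le> i \<le> n\<close>. The plane is \<^typ>\<open>real \<times> real\<close>, whose
  norm is the Euclidean one.\<close>

definition line_point :: "real \<Rightarrow> nat \<Rightarrow> nat \<Rightarrow> nat \<Rightarrow> real \<times> real" where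
  "line_point \<Delta> n a i =
     (if a = 1 then - \<Delta> / 2 else \<Delta> / 2, (real i - 1) / (real n - 1))"

text \<open>The \<open>2 n\<close> points listed as \<open>x\<^bsub>1,1\<^esub>, \<dots>, x\<^bsub>1,n\<^esub>, x\<^bsub>2,1\<^esub>, \<dots>, x\<^bsub>2,n\<^esub>\<close>, indexed from 0.\<close>

definition data_point :: "real \<Rightarrow> nat \<Rightarrow> nat \<Rightarrow> real \<times> real" where
  "data_point \<Delta> n p =
     (if p < n then line_point \<Delta> n 1 (p + 1) else line_point \<Delta> n 2 (p - n + 1))"

definition line_cluster :: "real \<Rightarrow> nat \<Rightarrow> nat \<Rightarrow> nat set" where
  "line_cluster \<Delta> n a = {p. p < 2 * n \<and> data_point \<Delta> n p \<in> line_point \<Delta> n a ` {1..n}}"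

definition lines_weight_mat :: "real \<Rightarrow> real \<Rightarrow> nat \<Rightarrow> real mat" where
  "lines_weight_mat \<sigma> \<Delta> n = weight_mat (2 * n) (heat_kernel \<sigma>) (data_point \<Delta> n)"

end

theory Submission
  imports Defs
begin

text \<open>Divide \<open>Z\<^sub>p\<^sub>q\<close> by \<open>u\<^sub>p u\<^sub>q\<close>, where \<open>u = 1\<close> for RatioCut and \<open>u = D\<^sup>1\<^sup>/\<^sup>2 1\<close> for NCut. Then \<open>Y\<close> is the
  Gram matrix of points \<open>y\<^sub>p\<close>, the objective is \<open>1/2 \<Sum> W\<^sub>p\<^sub>q |y\<^sub>p - y\<^sub>q|\<^sup>2\<close>, and \<open>W\<close> has diagonal blocks \<open>K\<close> and
  off-diagonal blocks \<open>c K\<close>. Put \<open>m\<^sub>i = u\<^sub>i\<^sup>2\<close> and let \<open>b\<close> be the \<open>m\<close>-weighted sum of an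
  off-diagonal block of \<open>Y\<close>. The row and trace constraints force the \<open>m\<close>-weighted sum of squared
  distances within the two clusters to be exactly \<open>4 b\<close>, so by a Poincare inequality on the path the
  nearest-neighbour weights alone contribute at least a multiple of \<open>b\<close> to the objective.
  Bounding each squared distance across the clusters below by its linearization at the difference of
  the cluster means shows that the off-diagonal blocks fall short of their value at the partition
  matrix by at most another multiple of \<open>b\<close>. The separation condition says \<open>c \<le> \<kappa> / n\<^sup>3\<close> for the
  nearest-neighbour weight \<open>\<kappa>\<close>, so the first multiple is larger; hence \<open>b = 0\<close> at a minimizer, and
  all points within a cluster coincide.\<close>

section \<open>Positive semidefinite kernels\<close>

locale psd_kernel =
  fixes N :: nat and Y :: "nat \<Rightarrow> nat \<Rightarrow> real"
  assumes sym: "\<lbrakk>p < N; q < N\<rbrakk> \<Longrightarrow> Y p q = Y q p"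
    and psd: "0 \<le> (\<Sum>p<N. f p * (\<Sum>q<N. Y p q * f q))"
begin

text \<open>This stands for the inner product of the combinations of points with coefficients
  \<open>f\<close> and \<open>g\<close>, so no Gram factorization of \<open>Y\<close> has to be
  constructed.\<close>

definition bil :: "(nat \<Rightarrow> real) \<Rightarrow> (nat \<Rightarrow> real) \<Rightarrow> real" where
  "bil f g = (\<Sum>p<N. f p * (\<Sum>q<N. Y p q * g q))"

definition sqdist :: "nat \<Rightarrow> nat \<Rightarrow> real" where
  "sqdist p q = Y p p + Y q q - 2 * Y p q"

definition point :: "nat \<Rightarrow> nat \<Rightarrow> real" where
  "point p = (\<lambda>k. of_bool (k = p))"

lemma bil_nonneg: "0 \<le> bil f f"
  unfolding bil_def by (rule psd)

lemma bil_commute: "bil f g = bil g f"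
proof -
  have "bil f g = (\<Sum>p<N. \<Sum>q<N. f p * Y p q * g q)"
    by (simp add: bil_def sum_distrib_left mult.assoc)
  also have "\<dots> = (\<Sum>q<N. \<Sum>p<N. f p * Y p q * g q)"
    by (rule sum.swap)
  also have "\<dots> = (\<Sum>q<N. \<Sum>p<N. g q * Y q p * f p)"
    by (intro sum.cong refl) (auto simp: sym)
  also have "\<dots> = bil g f"
    by (simp add: bil_def sum_distrib_left mult.assoc)
  finally show ?thesis .
qed

lemma bil_add_left: "bil (\<lambda>k. f k + g k) h = bil f h + bil g h"
  by (simp add: bil_def algebra_simps sum.distrib)

lemma bil_diff_left: "bil (\<lambda>k. f k - g k) h = bil f h - bil g h"
  by (simp add: bil_def algebra_simps sum_subtractf)

lemma bil_scale_left: "bil (\<lambda>k. a * f k) h = a * bil f h"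
  by (simp add: bil_def sum_distrib_left mult.assoc)

lemma bil_add_right: "bil h (\<lambda>k. f k + g k) = bil h f + bil h g"
  unfolding bil_commute[of h] by (rule bil_add_left)

lemma bil_diff_right: "bil h (\<lambda>k. f k - g k) = bil h f - bil h g"
  unfolding bil_commute[of h] by (rule bil_diff_left)

lemma bil_scale_right: "bil h (\<lambda>k. a * f k) = a * bil h f"
  unfolding bil_commute[of h] by (rule bil_scale_left)

lemmas bil_linear = bil_add_left bil_diff_left bil_scale_left
  bil_add_right bil_diff_right bil_scale_right

lemma bil_point_left: "p < N \<Longrightarrow> bil (point p) g = (\<Sum>q<N. Y p q * g q)"
  by (simp add: bil_def point_def)

lemma bil_point_point: "\<lbrakk>p < N; q < N\<rbrakk> \<Longrightarrow> bil (point p) (point q) = Y p q"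
  by (simp add: bil_point_left) (simp add: point_def)

section \<open>Squared distances between the points of the kernel\<close>

lemma sqdist_commute: "\<lbrakk>p < N; q < N\<rbrakk> \<Longrightarrow> sqdist p q = sqdist q p"
  by (simp add: sqdist_def sym)

lemma sqdist_eq_bil:
  "\<lbrakk>p < N; q < N\<rbrakk> \<Longrightarrow> sqdist p q = bil (\<lambda>k. point p k - point q k) (\<lambda>k. point p k - point q k)"
  by (simp add: bil_linear bil_point_point sqdist_def sym)

lemma sqdist_nonneg: "\<lbrakk>p < N; q < N\<rbrakk> \<Longrightarrow> 0 \<le> sqdist p q"
  by (simp add: sqdist_eq_bil bil_nonneg)

text \<open>Expands |x - t z|^2 >= 0 for the steps x = y_p - y_q and z = y_q - y_r. It is |x + z|^2
  <= (1 + 1/t) |x|^2 + (1 + t) |z|^2 with denominators cleared.\<close>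

lemma sqdist_step:
  assumes "p < N" "q < N" "r < N"
  shows "t * sqdist p r \<le> (t + 1) * (sqdist p q + t * sqdist q r)"
proof -
  have "0 \<le> bil (\<lambda>k. (point p k - point q k) - t * (point q k - point r k))
              (\<lambda>k. (point p k - point q k) - t * (point q k - point r k))"
    by (rule bil_nonneg)
  also have "\<dots> = (t + 1) * (sqdist p q + t * sqdist q r) - t * sqdist p r"
    using assms sym by (simp add: bil_linear bil_point_point sqdist_def) (simp add: algebra_simps)
  finally show ?thesis by simp
qed

text \<open>Cauchy-Schwarz for a telescoping sum, by induction on the number of edges: the weight
  \<open>t = k\<close> in \<open>sqdist_step\<close> balances the k edges already walked against the
  new one.\<close>

lemma sqdist_path:
  assumes "base + i + k < N"
  shows "sqdist (base + i) (base + i + k)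
    \<le> real k * (\<Sum>e = i..<i + k. sqdist (base + e) (base + Suc e))"
  using assms
proof (induction k)
  case 0
  then show ?case by (simp add: sqdist_def)
next
  case (Suc k)
  show ?case
  \<comment> \<open>The induction step ends by cancelling \<open>real k\<close>, so a path of a
    single edge is treated apart.\<close>
  proof (cases "k = 0")
    case True
    then show ?thesis by simp
  next
    case False
    let ?T = "\<Sum>e = i..<i + k. sqdist (base + e) (base + Suc e)"
    let ?s = "sqdist (base + i + k) (base + i + Suc k)"
    have IH: "sqdist (base + i) (base + i + k) \<le> real k * ?T"
      using Suc by simp
    have "real k * sqdist (base + i) (base + i + Suc k)
        \<le> (real k + 1) * (sqdist (base + i) (base + i + k) + real k * ?s)"
      by (rule sqdist_step) (use Suc in auto)
    also have "\<dots> \<le> (real k + 1) * (real k * ?T + real k * ?s)"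
      using IH by (intro mult_left_mono) auto
    also have "\<dots> = real k * (real (Suc k) * (?T + ?s))"
      by (simp add: algebra_simps)
    finally have "sqdist (base + i) (base + i + Suc k) \<le> real (Suc k) * (?T + ?s)"
      using False by simp
    then show ?thesis by (simp add: add.assoc)
  qed
qed

text \<open>Extending the sum to all edges leaves i and j only in the factor |i - j|, so the later
  double sum splits. The offset \<open>base\<close> lets one lemma serve both clusters.\<close>

lemma sqdist_le_path_length:
  assumes "i < n" "j < n" "base + n \<le> N"
  shows "sqdist (base + i) (base + j)
    \<le> \<bar>real i - real j\<bar> * (\<Sum>e<n - 1. sqdist (base + e) (base + Suc e))"
proof -
  have *: "sqdist (base + i) (base + j)
      \<le> \<bar>real i - real j\<bar> * (\<Sum>e<n - 1. sqdist (base + e) (base + Suc e))"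
    if "i \<le> j" "j < n" for i j
  proof -
    have "sqdist (base + i) (base + i + (j - i))
        \<le> real (j - i) * (\<Sum>e = i..<i + (j - i). sqdist (base + e) (base + Suc e))"
      by (rule sqdist_path) (use that assms in auto)
    also have "\<dots> \<le> real (j - i) * (\<Sum>e<n - 1. sqdist (base + e) (base + Suc e))"
      by (intro mult_left_mono sum_mono2) (use that assms in \<open>auto intro!: sqdist_nonneg\<close>)
    finally show ?thesis using that by (simp add: of_nat_diff)
  qed
  show ?thesis
  proof (cases "i \<le> j")
    case True
    then show ?thesis using * assms by blast
  next
    case False
    then have "sqdist (base + j) (base + i)
      \<le> \<bar>real j - real i\<bar> * (\<Sum>e<n - 1. sqdist (base + e) (base + Suc e))"
      using *[of j i] assms by simp
    then show ?thesis using assms by (simp add: abs_minus_commute sqdist_commute)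
  qed
qed

text \<open>The squared length of y_r + t (y_p - y_q) is affine in t once y_p - y_q has length zero,
  and it is bounded below, so its slope 2 (Y p r - Y q r) must vanish.\<close>

lemma sqdist_zero_imp_eq:
  assumes "p < N" "q < N" "r < N" and zero: "sqdist p q = 0"
  shows "Y p r = Y q r"
proof (rule ccontr)
  assume "Y p r \<noteq> Y q r"
  define a where "a = Y p r - Y q r"
  then have "a \<noteq> 0" using \<open>Y p r \<noteq> Y q r\<close> by simp
  \<comment> \<open>Chosen so that the affine function takes the value -1.\<close>
  define t where "t = - (Y r r + 1) / (2 * a)"
  have "0 \<le> bil (\<lambda>k. point r k + t * (point p k - point q k))
              (\<lambda>k. point r k + t * (point p k - point q k))"
    by (rule bil_nonneg)
  also have "\<dots> = Y r r + 2 * t * a + t\<^sup>2 * sqdist p q"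
    unfolding a_def using assms(1-3) sym
    by (simp add: bil_linear bil_point_point sqdist_def) (simp add: algebra_simps power2_eq_square)
  also have "\<dots> = -1"
    using \<open>a \<noteq> 0\<close> by (simp add: zero t_def field_simps)
  finally show False by simp
qed

end

section \<open>Sums over index ranges\<close>

lemma sum_lessThan_double:
  fixes f :: "nat \<Rightarrow> real"
  shows "(\<Sum>p<2 * n. f p) = (\<Sum>i<n. f i) + (\<Sum>i<n. f (n + i))"
proof -
  have "(\<Sum>p<2 * n. f p) = (\<Sum>i\<in>{0..<n}. f i) + (\<Sum>i\<in>{n..<2 * n}. f i)"
    by (simp add: sum.atLeastLessThan_concat flip: atLeast0LessThan)
  also have "(\<Sum>i\<in>{n..<2 * n}. f i) = (\<Sum>i\<in>{0..<n}. f (n + i))"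
    using sum.shift_bounds_nat_ivl[of f 0 n n] by (simp add: mult_2 add.commute)
  finally show ?thesis by (simp add: atLeast0LessThan)
qed

text \<open>Pairs j with its mirror image n - 1 - j: wherever i lies, the two distances add up to at
  most n - 1.\<close>

lemma sum_index_distance_le:
  assumes "i < n"
  shows "(\<Sum>j<n. \<bar>real i - real j\<bar>) \<le> real n * (real n - 1) / 2"
proof -
  have "2 * (\<Sum>j<n. \<bar>real i - real j\<bar>)
      = (\<Sum>j<n. \<bar>real i - real j\<bar>) + (\<Sum>j<n. \<bar>real i - real (n - Suc j)\<bar>)"
    by (simp only: sum.nat_diff_reindex[where g="\<lambda>j. \<bar>real i - real j\<bar>"])
  also have "\<dots> = (\<Sum>j<n. \<bar>real i - real j\<bar> + \<bar>real i - real (n - Suc j)\<bar>)"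
    by (simp add: sum.distrib)
  also have "\<dots> \<le> (\<Sum>j<n. real n - 1)"
    using assms by (intro sum_mono) (auto simp: of_nat_diff abs_if)
  finally show ?thesis by simp
qed

text \<open>The pairs (e, e+1) and (e+1, e) form disjoint subsets of the index square, so by
  symmetry every edge occurs twice on the right.\<close>

lemma sum_consecutive_le:
  fixes g :: "nat \<Rightarrow> nat \<Rightarrow> real"
  assumes nonneg: "\<And>i j. \<lbrakk>i < n; j < n\<rbrakk> \<Longrightarrow> 0 \<le> g i j"
    and sym: "\<And>i j. \<lbrakk>i < n; j < n\<rbrakk> \<Longrightarrow> g i j = g j i"
  shows "2 * (\<Sum>e<n - 1. g e (Suc e)) \<le> (\<Sum>i<n. \<Sum>j<n. g i j)"
proof -
  let ?U = "(\<lambda>e. (e, Suc e)) ` {..<n - 1}" and ?V = "(\<lambda>e. (Suc e, e)) ` {..<n - 1}"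
  have "(\<Sum>e<n - 1. g e (Suc e)) = (\<Sum>e<n - 1. g (Suc e) e)"
    by (intro sum.cong refl sym) auto
  then have "2 * (\<Sum>e<n - 1. g e (Suc e)) = (\<Sum>e<n - 1. g e (Suc e)) + (\<Sum>e<n - 1. g (Suc e) e)"
    by simp
  also have "\<dots> = (\<Sum>(i, j)\<in>?U. g i j) + (\<Sum>(i, j)\<in>?V. g i j)"
    by (subst (1 2) sum.reindex) (auto simp: inj_on_def)
  also have "\<dots> = (\<Sum>(i, j)\<in>?U \<union> ?V. g i j)"
    by (rule sum.union_disjoint[symmetric]) auto
  also have "\<dots> \<le> (\<Sum>(i, j)\<in>{..<n} \<times> {..<n}. g i j)"
    by (rule sum_mono2) (auto intro: nonneg)
  finally show ?thesis by (simp add: sum.cartesian_product)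
qed

section \<open>Two clusters of equal size\<close>

text \<open>Abstracts a rescaled feasible matrix. Both clusters carry the same masses
  \<open>m\<close>; \<open>row\<close> and \<open>weighted_trace\<close> are what the fixed-vector
  and trace constraints become after rescaling.\<close>

locale two_cluster_kernel = psd_kernel "2 * n" Y for n Y +
  fixes m :: "nat \<Rightarrow> real"
  assumes n_pos: "0 < n"
    and m_pos: "i < n \<Longrightarrow> 0 < m i"
    and nonneg: "\<lbrakk>p < 2 * n; q < 2 * n\<rbrakk> \<Longrightarrow> 0 \<le> Y p q"
    and row: "p < 2 * n \<Longrightarrow> (\<Sum>k<n. m k * Y p k) + (\<Sum>k<n. m k * Y p (n + k)) = 1"
    and weighted_trace: "(\<Sum>i<n. m i * Y i i) + (\<Sum>i<n. m i * Y (n + i) (n + i)) = 2"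
begin

section \<open>Mass leaking between the clusters and spread within them\<close>

definition mass :: real where "mass = (\<Sum>i<n. m i)"

text \<open>By \<open>row\<close>, \<open>1 - leak1 i\<close> is the mass that row i keeps in its
  own cluster. The weighted total \<open>leak\<close> is the b of the introductory text.\<close>

definition leak1 :: "nat \<Rightarrow> real" where "leak1 i = (\<Sum>k<n. m k * Y i (n + k))"

definition leak2 :: "nat \<Rightarrow> real" where "leak2 i = (\<Sum>k<n. m k * Y (n + i) k)"

definition leak :: real where "leak = (\<Sum>i<n. m i * leak1 i)"

lemma mass_pos: "0 < mass"
  unfolding mass_def using n_pos by (intro sum_pos m_pos) auto

lemma leak1_nonneg: "i < n \<Longrightarrow> 0 \<le> leak1 i"
  unfolding leak1_def by (intro sum_nonneg mult_nonneg_nonneg nonneg less_imp_le[OF m_pos]) auto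

lemma leak2_nonneg: "i < n \<Longrightarrow> 0 \<le> leak2 i"
  unfolding leak2_def by (intro sum_nonneg mult_nonneg_nonneg nonneg less_imp_le[OF m_pos]) auto

lemma leak_nonneg: "0 \<le> leak"
  unfolding leak_def
  by (intro sum_nonneg mult_nonneg_nonneg leak1_nonneg less_imp_le[OF m_pos]) auto

lemma leak_eq_leak2: "leak = (\<Sum>i<n. m i * leak2 i)"
proof -
  have "leak = (\<Sum>i<n. \<Sum>k<n. m i * (m k * Y i (n + k)))"
    by (simp add: leak_def leak1_def sum_distrib_left)
  also have "\<dots> = (\<Sum>k<n. \<Sum>i<n. m i * (m k * Y i (n + k)))"
    by (rule sum.swap)
  also have "\<dots> = (\<Sum>k<n. \<Sum>i<n. m k * (m i * Y (n + k) i))"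
    using sym by (intro sum.cong refl) auto
  finally show ?thesis by (simp add: leak2_def sum_distrib_left)
qed

lemma within1: "i < n \<Longrightarrow> (\<Sum>k<n. m k * Y i k) = 1 - leak1 i"
  using row[of i] by (simp add: leak1_def)

lemma within2: "i < n \<Longrightarrow> (\<Sum>k<n. m k * Y (n + i) (n + k)) = 1 - leak2 i"
  using row[of "n + i"] by (simp add: leak2_def)

text \<open>Weighted variance identity for one block; \<open>B\<close> is arbitrary so that both
  diagonal blocks are instances.\<close>

lemma within_spread_aux:
  "(\<Sum>i<n. \<Sum>j<n. m i * m j * (B i i + B j j - 2 * B i j))
    = 2 * mass * (\<Sum>i<n. m i * B i i) - 2 * (\<Sum>i<n. m i * (\<Sum>j<n. m j * B i j))"
proof -
  have 1: "(\<Sum>i<n. \<Sum>j<n. m i * m j * B i i) = mass * (\<Sum>i<n. m i * B i i)"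
    unfolding mass_def sum_product by (subst sum.swap) (simp add: mult_ac)
  have 2: "(\<Sum>i<n. \<Sum>j<n. m i * m j * B j j) = mass * (\<Sum>i<n. m i * B i i)"
    unfolding mass_def sum_product by (simp add: mult_ac)
  have 3: "(\<Sum>i<n. \<Sum>j<n. m i * m j * B i j) = (\<Sum>i<n. m i * (\<Sum>j<n. m j * B i j))"
    by (simp add: sum_distrib_left mult.assoc)
  have "(\<Sum>i<n. \<Sum>j<n. m i * m j * (B i i + B j j - 2 * B i j))
    = (\<Sum>i<n. \<Sum>j<n. m i * m j * B i i) + (\<Sum>i<n. \<Sum>j<n. m i * m j * B j j)
      - 2 * (\<Sum>i<n. \<Sum>j<n. m i * m j * B i j)"
    by (simp add: sum_distrib_left sum.distrib sum_subtractf algebra_simps)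
  then show ?thesis using 1 2 3 by simp
qed

text \<open>The trace constraint fixes the diagonal contribution at \<open>4 * mass\<close>, the row
  constraints fix both block sums at \<open>mass - leak\<close>, and the masses cancel.\<close>

lemma within_spread:
  "(\<Sum>i<n. \<Sum>j<n. m i * m j * sqdist i j) + (\<Sum>i<n. \<Sum>j<n. m i * m j * sqdist (n + i) (n + j))
    = 4 * leak"
proof -
  have 1: "(\<Sum>i<n. m i * (\<Sum>j<n. m j * Y i j)) = mass - leak"
    by (simp add: within1 leak_def mass_def right_diff_distrib sum_subtractf)
  have 2: "(\<Sum>i<n. m i * (\<Sum>j<n. m j * Y (n + i) (n + j))) = mass - leak"
    by (simp add: within2 leak_eq_leak2 mass_def right_diff_distrib sum_subtractf)
  have "(\<Sum>i<n. \<Sum>j<n. m i * m j * sqdist i j)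
      + (\<Sum>i<n. \<Sum>j<n. m i * m j * sqdist (n + i) (n + j))
    = 2 * mass * ((\<Sum>i<n. m i * Y i i) + (\<Sum>i<n. m i * Y (n + i) (n + i))) - 4 * (mass - leak)"
    unfolding sqdist_def
    using within_spread_aux[of Y] within_spread_aux[of "\<lambda>i j. Y (n + i) (n + j)"] 1 2
    by (simp add: algebra_simps)
  then show ?thesis using weighted_trace by simp
qed

section \<open>Poincare inequality on the path\<close>

definition path_energy :: "nat \<Rightarrow> real" where
  "path_energy base = (\<Sum>e<n - 1. sqdist (base + e) (base + Suc e))"

lemma path_energy_nonneg: "base + n \<le> 2 * n \<Longrightarrow> 0 \<le> path_energy base"
  unfolding path_energy_def by (intro sum_nonneg sqdist_nonneg) auto

text \<open>Of the two masses in each term, \<open>m j\<close> is replaced by \<open>M\<close>,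
  which leaves a plain sum of index distances over j; \<open>m i\<close> is kept and sums to
  \<open>mass\<close>.\<close>

lemma spread_le_path_energy:
  assumes "base + n \<le> 2 * n" and M: "\<And>i. i < n \<Longrightarrow> m i \<le> M"
  shows "(\<Sum>i<n. \<Sum>j<n. m i * m j * sqdist (base + i) (base + j))
    \<le> M * mass * (real n * (real n - 1) / 2) * path_energy base"
proof -
  have M0: "0 \<le> M" using M[of 0] m_pos[of 0] n_pos by simp
  have "(\<Sum>j<n. m i * m j * sqdist (base + i) (base + j))
      \<le> m i * (M * (real n * (real n - 1) / 2) * path_energy base)" if i: "i < n" for i
  proof -
    have "(\<Sum>j<n. m i * m j * sqdist (base + i) (base + j))
        \<le> (\<Sum>j<n. m i * M * (\<bar>real i - real j\<bar> * path_energy base))"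
    proof (rule sum_mono)
      fix j assume "j \<in> {..<n}"
      then have j: "j < n" by simp
      have "sqdist (base + i) (base + j) \<le> \<bar>real i - real j\<bar> * path_energy base"
        unfolding path_energy_def by (rule sqdist_le_path_length) (use i j assms in auto)
      then show "m i * m j * sqdist (base + i) (base + j)
          \<le> m i * M * (\<bar>real i - real j\<bar> * path_energy base)"
        using m_pos[OF i] m_pos[OF j] M[OF j] M0 i j assms(1)
        by (intro mult_mono) (auto intro!: sqdist_nonneg)
    qed
    also have "\<dots> = (m i * M * path_energy base) * (\<Sum>j<n. \<bar>real i - real j\<bar>)"
      by (simp add: sum_distrib_left mult_ac)
    also have "\<dots> \<le> (m i * M * path_energy base) * (real n * (real n - 1) / 2)"
      using m_pos[OF i] M0 path_energy_nonneg[OF assms(1)]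
      by (intro mult_left_mono sum_index_distance_le[OF i]) auto
    finally show ?thesis by (simp add: mult_ac)
  qed
  then have "(\<Sum>i<n. \<Sum>j<n. m i * m j * sqdist (base + i) (base + j))
      \<le> (\<Sum>i<n. m i * (M * (real n * (real n - 1) / 2) * path_energy base))"
    by (intro sum_mono) auto
  also have "\<dots> = M * mass * (real n * (real n - 1) / 2) * path_energy base"
    unfolding mass_def sum_distrib_right[symmetric] by (simp only: mult_ac)
  finally show ?thesis .
qed

lemma leak_le_path_energy:
  assumes "\<And>i. i < n \<Longrightarrow> m i \<le> M"
  shows "8 * leak \<le> M * mass * (real n * (real n - 1)) * (path_energy 0 + path_energy n)"
proof -
  let ?q = "real n * (real n - 1)"
  have "(\<Sum>i<n. \<Sum>j<n. m i * m j * sqdist i j) \<le> M * mass * (?q / 2) * path_energy 0"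
    using spread_le_path_energy[of 0 M] assms by simp
  moreover have "(\<Sum>i<n. \<Sum>j<n. m i * m j * sqdist (n + i) (n + j))
      \<le> M * mass * (?q / 2) * path_energy n"
    by (rule spread_le_path_energy) (simp_all add: assms)
  ultimately have "4 * leak \<le> M * mass * (?q / 2) * path_energy 0 + M * mass * (?q / 2) * path_energy n"
    using within_spread by linarith
  also have "\<dots> = M * mass * ?q * (path_energy 0 + path_energy n) / 2"
    by (simp only: distrib_left add_divide_distrib) simp
  finally show ?thesis by linarith
qed

text \<open>Writing \<open>Y\<close> as the Gram matrix of points, this linearizes the squared distance of two points
  at the difference of the two cluster means.\<close>

lemma sqdist_across_ge:
  assumes "i < n" "j < n"
  shows "2 / mass - 4 * (leak1 i + leak2 j) / mass \<le> sqdist i (n + j)"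
proof -
  \<comment> \<open>\<open>z / mass\<close> represents the difference of the two weighted cluster
    means.\<close>
  define z where "z = (\<lambda>q. if q < n then m q else - m (q - n))"
  have pz: "bil (point p) z = (\<Sum>k<n. m k * Y p k) - (\<Sum>k<n. m k * Y p (n + k))"
    if "p < 2 * n" for p
    using that
    by (simp only: bil_point_left sum_lessThan_double z_def) (simp add: sum_negf mult.commute)
  have pz1: "bil (point i) z = 1 - 2 * leak1 i" if "i < n" for i
    using that by (simp add: pz within1) (simp add: leak1_def)
  have pz2: "bil (point (n + j)) z = 2 * leak2 j - 1" if "j < n" for j
    using that by (simp add: pz within2) (simp add: leak2_def)
  have z1: "z k = m k" and z2: "z (n + k) = - m k" if "k < n" for k
    using that by (simp_all add: z_def)
  have "bil z z = (\<Sum>p<2 * n. z p * bil (point p) z)"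
    by (simp add: bil_def[of z z] bil_point_left)
  also have "\<dots> = (\<Sum>k<n. m k * (1 - 2 * leak1 k)) + (\<Sum>k<n. - m k * (2 * leak2 k - 1))"
    unfolding sum_lessThan_double
    by (intro arg_cong2[where f = "(+)"] sum.cong refl) (simp_all add: z1 z2 pz1 pz2)
  also have "\<dots> = 2 * mass - 2 * leak - 2 * (\<Sum>k<n. m k * leak2 k)"
    by (simp add: leak_def mass_def algebra_simps sum.distrib sum_subtractf sum_distrib_left sum_negf)
  also have "\<dots> = 2 * mass - 4 * leak"
    by (simp add: leak_eq_leak2[symmetric])
  finally have zz: "bil z z = 2 * mass - 4 * leak" .
  let ?a = "\<lambda>k. point i k - point (n + j) k"
  have "0 \<le> bil (\<lambda>k. ?a k - (1 / mass) * z k) (\<lambda>k. ?a k - (1 / mass) * z k)"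
    by (rule bil_nonneg)
  also have "\<dots> = bil ?a ?a - 2 * (1 / mass) * bil ?a z + (1 / mass)\<^sup>2 * bil z z"
    using bil_commute[of z ?a]
    by (simp only: bil_diff_left[of ?a] bil_diff_right[of _ ?a] bil_scale_left bil_scale_right)
      (simp add: power2_eq_square)
  also have "bil ?a ?a = sqdist i (n + j)"
    using assms by (simp add: sqdist_eq_bil)
  also have "bil ?a z = 2 - 2 * leak1 i - 2 * leak2 j"
    using assms by (simp add: bil_diff_left pz1 pz2)
  finally have "0 \<le> sqdist i (n + j) - 2 * (1 / mass) * (2 - 2 * leak1 i - 2 * leak2 j)
    + (1 / mass)\<^sup>2 * (2 * mass - 4 * leak)"
    unfolding zz .
  \<comment> \<open>Dropping \<open>- 4 * leak\<close> only enlarges the right side and leaves a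
    bound that involves just row i and row n + j.\<close>
  also have "\<dots> \<le> sqdist i (n + j) - 2 * (1 / mass) * (2 - 2 * leak1 i - 2 * leak2 j)
    + (1 / mass)\<^sup>2 * (2 * mass)"
    using leak_nonneg by (intro add_left_mono mult_left_mono) auto
  also have "\<dots> = sqdist i (n + j) - (2 / mass - 4 * (leak1 i + leak2 j) / mass)"
    using mass_pos by (simp add: field_simps power2_eq_square)
  finally show ?thesis by simp
qed

text \<open>Half the weighted sum of squared distances over all ordered pairs, split into blocks.
  The two off-diagonal blocks agree, which absorbs their factor one half.\<close>

definition energy :: "(nat \<Rightarrow> nat \<Rightarrow> real) \<Rightarrow> real \<Rightarrow> real" where
  "energy K c = (\<Sum>i<n. \<Sum>j<n. K i j * sqdist i j) / 2
    + (\<Sum>i<n. \<Sum>j<n. K i j * sqdist (n + i) (n + j)) / 2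
    + c * (\<Sum>i<n. \<Sum>j<n. K i j * sqdist i (n + j))"

section \<open>Lower bound for the energy in terms of the leak\<close>

context
  fixes K :: "nat \<Rightarrow> nat \<Rightarrow> real" and c \<kappa> M R :: real
  assumes K_sym: "\<lbrakk>i < n; j < n\<rbrakk> \<Longrightarrow> K i j = K j i"
    and K_nonneg: "\<lbrakk>i < n; j < n\<rbrakk> \<Longrightarrow> 0 \<le> K i j"
    and K_consecutive: "Suc e < n \<Longrightarrow> \<kappa> \<le> K e (Suc e)"
    and c_nonneg: "0 \<le> c"
    and m_le: "i < n \<Longrightarrow> m i \<le> M"
    and degree_le: "i < n \<Longrightarrow> (\<Sum>j<n. K i j) \<le> R * m i"
    and gap: "c * R * M * (real n * (real n - 1)) < \<kappa>"
    and n_gt_1: "1 < n"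
begin

text \<open>Only the edges between neighbours are kept from the double sum; each occurs there twice,
  which matches the division by 2.\<close>

lemma path_energy_le:
  assumes "base + n \<le> 2 * n"
  shows "\<kappa> * path_energy base \<le> (\<Sum>i<n. \<Sum>j<n. K i j * sqdist (base + i) (base + j)) / 2"
proof -
  have 1: "\<kappa> * path_energy base \<le> (\<Sum>e<n - 1. K e (Suc e) * sqdist (base + e) (base + Suc e))"
    unfolding path_energy_def sum_distrib_left
    using assms by (intro sum_mono mult_right_mono K_consecutive sqdist_nonneg) auto
  have 2: "2 * (\<Sum>e<n - 1. K e (Suc e) * sqdist (base + e) (base + Suc e))
      \<le> (\<Sum>i<n. \<Sum>j<n. K i j * sqdist (base + i) (base + j))"
  proof (rule sum_consecutive_le[where g = "\<lambda>i j. K i j * sqdist (base + i) (base + j)"])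
    fix i j assume ij: "i < n" "j < n"
    show "0 \<le> K i j * sqdist (base + i) (base + j)"
      using ij assms by (intro mult_nonneg_nonneg K_nonneg sqdist_nonneg) auto
    show "K i j * sqdist (base + i) (base + j) = K j i * sqdist (base + j) (base + i)"
      using ij assms K_sym[OF ij] sqdist_commute[of "base + i" "base + j"] by simp
  qed
  show ?thesis using 1 2 by linarith
qed

text \<open>Sums \<open>sqdist_across_ge\<close> against \<open>K\<close>. The degree bound makes
  each leak term at most \<open>R * leak\<close>; for \<open>leak2\<close> the sums are exchanged
  first, by symmetry of \<open>K\<close>.\<close>

lemma cross_energy_ge:
  "2 * (\<Sum>i<n. \<Sum>j<n. K i j) / mass - 8 * R * leak / mass
    \<le> (\<Sum>i<n. \<Sum>j<n. K i j * sqdist i (n + j))"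
proof -
  have 1: "(\<Sum>i<n. \<Sum>j<n. K i j * leak1 i) \<le> R * leak"
  proof -
    have "(\<Sum>i<n. \<Sum>j<n. K i j * leak1 i) = (\<Sum>i<n. (\<Sum>j<n. K i j) * leak1 i)"
      by (simp add: sum_distrib_right)
    also have "\<dots> \<le> (\<Sum>i<n. R * m i * leak1 i)"
      by (intro sum_mono mult_right_mono degree_le leak1_nonneg) auto
    finally show ?thesis by (simp add: leak_def sum_distrib_left mult_ac)
  qed
  have 2: "(\<Sum>i<n. \<Sum>j<n. K i j * leak2 j) \<le> R * leak"
  proof -
    have "(\<Sum>i<n. \<Sum>j<n. K i j * leak2 j) = (\<Sum>j<n. \<Sum>i<n. K j i * leak2 j)"
      by (subst sum.swap) (intro sum.cong refl, auto simp: K_sym)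
    also have "\<dots> = (\<Sum>j<n. (\<Sum>i<n. K j i) * leak2 j)"
      by (simp add: sum_distrib_right)
    also have "\<dots> \<le> (\<Sum>j<n. R * m j * leak2 j)"
      by (intro sum_mono mult_right_mono degree_le leak2_nonneg) auto
    finally show ?thesis by (simp add: leak_eq_leak2 sum_distrib_left mult_ac)
  qed
  have "2 * (\<Sum>i<n. \<Sum>j<n. K i j) / mass - 8 * R * leak / mass
      \<le> 2 * (\<Sum>i<n. \<Sum>j<n. K i j) / mass
        - 4 * ((\<Sum>i<n. \<Sum>j<n. K i j * leak1 i) + (\<Sum>i<n. \<Sum>j<n. K i j * leak2 j)) / mass"
    using 1 2 mass_pos by (simp add: divide_right_mono)
  also have "\<dots> = (\<Sum>i<n. \<Sum>j<n. K i j * (2 / mass - 4 * (leak1 i + leak2 j) / mass))"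
  proof -
    have "(\<Sum>i<n. \<Sum>j<n. K i j * (2 / mass - 4 * (leak1 i + leak2 j) / mass))
        = (\<Sum>i<n. \<Sum>j<n. 2 / mass * K i j - 4 / mass * (K i j * leak1 i) - 4 / mass * (K i j * leak2 j))"
      using mass_pos by (intro sum.cong refl) (simp add: field_simps)
    also have "\<dots> = 2 / mass * (\<Sum>i<n. \<Sum>j<n. K i j)
        - 4 / mass * (\<Sum>i<n. \<Sum>j<n. K i j * leak1 i) - 4 / mass * (\<Sum>i<n. \<Sum>j<n. K i j * leak2 j)"
      by (simp only: sum_subtractf sum_distrib_left)
    finally show ?thesis
      by (simp add: distrib_left add_divide_distrib)
  qed
  also have "\<dots> \<le> (\<Sum>i<n. \<Sum>j<n. K i j * sqdist i (n + j))"
    by (intro sum_mono mult_left_mono sqdist_across_ge K_nonneg) auto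
  finally show ?thesis .
qed

lemma M_pos: "0 < M"
  using m_le[of 0] m_pos[of 0] n_pos by simp

text \<open>Within the clusters \<open>leak_le_path_energy\<close> forces energy proportional to
  \<open>leak\<close>; across them at most \<open>8 * c * R * leak / mass\<close> is lost against
  the value at the partition matrix. The bracket is the net rate.\<close>

lemma energy_gap:
  "2 * c * (\<Sum>i<n. \<Sum>j<n. K i j) / mass
     + 8 * leak / mass * (\<kappa> / (M * (real n * (real n - 1))) - c * R) \<le> energy K c"
proof -
  have R0: "0 \<le> R"
  proof -
    have "0 \<le> R * m 0"
      by (rule order_trans[OF sum_nonneg degree_le]) (use n_pos in \<open>auto intro: K_nonneg\<close>)
    then show ?thesis using m_pos[of 0] n_pos by (simp add: zero_le_mult_iff)
  qed
  let ?n2 = "real n * (real n - 1)"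
  have n2: "0 < ?n2" using n_gt_1 by simp
  have "0 \<le> c * R * M * ?n2"
    by (intro mult_nonneg_nonneg) (use c_nonneg R0 M_pos n_gt_1 in auto)
  \<comment> \<open>Multiplying the path inequality by \<open>\<kappa>\<close> needs its sign, which
    \<open>gap\<close> supplies once its left side is known to be nonnegative.\<close>
  then have k0: "0 \<le> \<kappa>" using gap by linarith
  have "0 < M * mass * ?n2"
    by (rule mult_pos_pos[OF mult_pos_pos[OF M_pos mass_pos] n2])
  moreover have "8 * leak \<le> (path_energy 0 + path_energy n) * (M * mass * ?n2)"
    using leak_le_path_energy[of M, OF m_le] by (simp only: mult.commute)
  ultimately have "8 * leak / (M * mass * ?n2) \<le> path_energy 0 + path_energy n"
    by (simp only: pos_divide_le_eq)
  then have "\<kappa> * (8 * leak / (M * mass * ?n2)) \<le> \<kappa> * path_energy 0 + \<kappa> * path_energy n"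
    unfolding distrib_left[symmetric] by (rule mult_left_mono[OF _ k0])
  also have "\<dots> \<le> (\<Sum>i<n. \<Sum>j<n. K i j * sqdist i j) / 2
    + (\<Sum>i<n. \<Sum>j<n. K i j * sqdist (n + i) (n + j)) / 2"
    using path_energy_le[of 0] path_energy_le[of n] by simp
  finally have "\<kappa> * (8 * leak / (M * mass * ?n2))
      + c * (2 * (\<Sum>i<n. \<Sum>j<n. K i j) / mass - 8 * R * leak / mass) \<le> energy K c"
    unfolding energy_def
    by (intro add_mono mult_left_mono cross_energy_ge c_nonneg)
  moreover have "\<kappa> * (8 * leak / (M * mass * ?n2))
      = 8 * leak / mass * (\<kappa> / (M * ?n2))"
    by (simp add: mult_ac)
  ultimately show ?thesis by (simp add: algebra_simps)
qed

lemma gap_factor_pos: "0 < \<kappa> / (M * (real n * (real n - 1))) - c * R"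
  using gap M_pos n_gt_1 by (simp add: less_divide_eq mult_ac)

lemma energy_ge: "2 * c * (\<Sum>i<n. \<Sum>j<n. K i j) / mass \<le> energy K c"
proof -
  have "0 \<le> 8 * leak / mass * (\<kappa> / (M * (real n * (real n - 1))) - c * R)"
    using leak_nonneg mass_pos gap_factor_pos by (intro mult_nonneg_nonneg) auto
  then show ?thesis using energy_gap by linarith
qed

lemma leak_zero_if_minimal:
  assumes "energy K c \<le> 2 * c * (\<Sum>i<n. \<Sum>j<n. K i j) / mass"
  shows "leak = 0"
proof (rule ccontr)
  assume "leak \<noteq> 0"
  then have "0 < 8 * leak / mass * (\<kappa> / (M * (real n * (real n - 1))) - c * R)"
    using leak_nonneg mass_pos gap_factor_pos by (intro mult_pos_pos) auto
  then show False using energy_gap assms by linarith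
qed

end

text \<open>A vanishing sum of nonnegative terms kills every entry between the clusters. Then
  \<open>within_spread\<close> makes the points of a cluster coincide, so each row is constant on
  its own cluster, and its weighted sum 1 fixes the constant.\<close>

lemma leak_zero_imp_block:
  assumes "leak = 0" "i < n" "j < n"
  shows "Y i (n + j) = 0" "Y (n + i) j = 0" "Y i j = 1 / mass" "Y (n + i) (n + j) = 1 / mass"
proof -
  have *: "Y i (n + j) = 0" if "i < n" "j < n" for i j
  proof -
    have "m i * leak1 i = 0"
      by (rule sum_nonneg_0[of "{..<n}" "\<lambda>i. m i * leak1 i"])
        (use assms(1) that in \<open>auto simp: leak_def intro!: mult_nonneg_nonneg leak1_nonneg less_imp_le[OF m_pos]\<close>)
    then have l: "leak1 i = 0" using m_pos[OF that(1)] by simp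
    have "m j * Y i (n + j) = 0"
      by (rule sum_nonneg_0[of "{..<n}" "\<lambda>j. m j * Y i (n + j)"])
        (use l that in \<open>auto simp: leak1_def intro!: mult_nonneg_nonneg nonneg less_imp_le[OF m_pos]\<close>)
    then show ?thesis using m_pos[OF that(2)] by simp
  qed
  then show "Y i (n + j) = 0" "Y (n + i) j = 0"
    using assms sym[of "n + i" j] by simp_all
  have const: "Y (base + i) (base + k) = Y (base + j) (base + k)"
    if base: "base + n \<le> 2 * n" and sum0: "(\<Sum>i<n. \<Sum>j<n. m i * m j * sqdist (base + i) (base + j)) = 0"
      and ijk: "i < n" "j < n" "k < n" for base i j k
  proof -
    have nn: "0 \<le> m i * m j * sqdist (base + i) (base + j)" if "i < n" "j < n" for i j
      using that base by (intro mult_nonneg_nonneg sqdist_nonneg less_imp_le[OF m_pos]) auto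
    have "(\<Sum>j<n. m i * m j * sqdist (base + i) (base + j)) = 0"
      by (rule sum_nonneg_0[OF _ _ sum0]) (use ijk in \<open>auto intro!: sum_nonneg nn\<close>)
    then have "m i * m j * sqdist (base + i) (base + j) = 0"
      by (rule sum_nonneg_0[rotated 2]) (use ijk in \<open>auto intro!: nn\<close>)
    then have "sqdist (base + i) (base + j) = 0"
      using m_pos[OF ijk(1)] m_pos[OF ijk(2)] by simp
    then show ?thesis using sqdist_zero_imp_eq base ijk by simp
  qed
  have nn: "0 \<le> (\<Sum>i<n. \<Sum>j<n. m i * m j * sqdist (base + i) (base + j))" if "base + n \<le> 2 * n" for base
    using that by (intro sum_nonneg mult_nonneg_nonneg sqdist_nonneg less_imp_le[OF m_pos]) auto
  \<comment> \<open>Written with \<open>0 + i\<close> to match \<open>const\<close> at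
    \<open>base = 0\<close>.\<close>
  have s1: "(\<Sum>i<n. \<Sum>j<n. m i * m j * sqdist (0 + i) (0 + j)) = 0"
    and s2: "(\<Sum>i<n. \<Sum>j<n. m i * m j * sqdist (n + i) (n + j)) = 0"
    using within_spread nn[of 0] nn[of n] \<open>leak = 0\<close> by auto
  have "(\<Sum>k<n. m k * Y i k) = (\<Sum>k<n. m k * Y i j)"
  proof (intro sum.cong refl)
    fix k assume k: "k \<in> {..<n}"
    have "Y k i = Y j i"
      using const[OF _ s1, of k j i] k assms by simp
    then show "m k * Y i k = m k * Y i j"
      using sym[of i k] sym[of i j] k assms by simp
  qed
  then have "1 - leak1 i = mass * Y i j"
    using assms by (simp add: within1 mass_def sum_distrib_right)
  moreover have "leak1 i = 0" using * assms by (simp add: leak1_def)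
  ultimately show "Y i j = 1 / mass" using mass_pos by (simp add: field_simps)
  have "(\<Sum>k<n. m k * Y (n + i) (n + k)) = (\<Sum>k<n. m k * Y (n + i) (n + j))"
  proof (intro sum.cong refl)
    fix k assume k: "k \<in> {..<n}"
    have "Y (n + k) (n + i) = Y (n + j) (n + i)"
      using const[OF _ s2, of k j i] k assms by simp
    then show "m k * Y (n + i) (n + k) = m k * Y (n + i) (n + j)"
      using sym[of "n + i" "n + k"] sym[of "n + i" "n + j"] k assms by simp
  qed
  then have "1 - leak2 i = mass * Y (n + i) (n + j)"
    using assms by (simp add: within2 mass_def sum_distrib_right)
  moreover have "leak2 i = 0"
  proof -
    have "Y (n + i) k = 0" if "k < n" for k
      using *[OF that assms(2)] sym[of "n + i" k] that assms by simp
    then show ?thesis by (simp add: leak2_def)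
  qed
  ultimately show "Y (n + i) (n + j) = 1 / mass" using mass_pos by (simp add: field_simps)
qed

end

section \<open>The Laplacian objective as an energy\<close>

lemma (in psd_kernel) laplacian_form_eq:
  assumes "\<And>p q. \<lbrakk>p < N; q < N\<rbrakk> \<Longrightarrow> w p q = w q p"
  shows "(\<Sum>p<N. (\<Sum>q<N. w p q) * Y p p) - (\<Sum>p<N. \<Sum>q<N. w p q * Y p q)
    = (\<Sum>p<N. \<Sum>q<N. w p q * sqdist p q) / 2"
proof -
  have 1: "(\<Sum>p<N. (\<Sum>q<N. w p q) * Y p p) = (\<Sum>p<N. \<Sum>q<N. w p q * Y p p)"
    by (simp only: sum_distrib_right)
  also have "\<dots> = (\<Sum>p<N. \<Sum>q<N. w q p * Y q q)"
    by (rule sum.swap)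
  also have "\<dots> = (\<Sum>p<N. \<Sum>q<N. w p q * Y q q)"
    by (intro sum.cong refl) (simp add: assms)
  finally have 2: "(\<Sum>p<N. (\<Sum>q<N. w p q) * Y p p) = (\<Sum>p<N. \<Sum>q<N. w p q * Y q q)" .
  have "(\<Sum>p<N. \<Sum>q<N. w p q * sqdist p q) = (\<Sum>p<N. \<Sum>q<N. w p q * Y p p)
      + (\<Sum>p<N. \<Sum>q<N. w p q * Y q q) - 2 * (\<Sum>p<N. \<Sum>q<N. w p q * Y p q)"
    by (simp add: sqdist_def algebra_simps sum.distrib sum_subtractf sum_distrib_left)
  then show ?thesis using 1 2 by simp
qed

lemma (in two_cluster_kernel) block_energy_eq:
  assumes "\<And>i j. \<lbrakk>i < n; j < n\<rbrakk> \<Longrightarrow> K i j = K j i"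
    and "\<And>i j. \<lbrakk>i < n; j < n\<rbrakk> \<Longrightarrow> w i j = K i j"
    and "\<And>i j. \<lbrakk>i < n; j < n\<rbrakk> \<Longrightarrow> w (n + i) (n + j) = K i j"
    and "\<And>i j. \<lbrakk>i < n; j < n\<rbrakk> \<Longrightarrow> w i (n + j) = c * K i j"
    and "\<And>i j. \<lbrakk>i < n; j < n\<rbrakk> \<Longrightarrow> w (n + i) j = c * K i j"
  shows "(\<Sum>p<2 * n. \<Sum>q<2 * n. w p q * sqdist p q) / 2 = energy K c"
proof -
  have 1: "(\<Sum>i<n. \<Sum>j<n. w i j * sqdist i j) = (\<Sum>i<n. \<Sum>j<n. K i j * sqdist i j)"
    by (intro sum.cong refl) (simp add: assms(2))
  have 2: "(\<Sum>i<n. \<Sum>j<n. w (n + i) (n + j) * sqdist (n + i) (n + j))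
      = (\<Sum>i<n. \<Sum>j<n. K i j * sqdist (n + i) (n + j))"
    by (intro sum.cong refl) (simp add: assms(3))
  have 3: "(\<Sum>i<n. \<Sum>j<n. w i (n + j) * sqdist i (n + j))
      = c * (\<Sum>i<n. \<Sum>j<n. K i j * sqdist i (n + j))"
    by (simp add: assms(4) sum_distrib_left mult.assoc)
  \<comment> \<open>The lower left block is reflected onto the upper right one, using symmetry of
    \<open>K\<close> and of \<open>sqdist\<close>.\<close>
  have "(\<Sum>i<n. \<Sum>j<n. w (n + i) j * sqdist (n + i) j)
      = (\<Sum>i<n. \<Sum>j<n. c * (K j i * sqdist j (n + i)))"
  proof (intro sum.cong refl)
    fix i j assume "i \<in> {..<n}" "j \<in> {..<n}"
    then show "w (n + i) j * sqdist (n + i) j = c * (K j i * sqdist j (n + i))"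
      using assms(1)[of i j] assms(5)[of i j] sqdist_commute[of "n + i" j] by simp
  qed
  also have "\<dots> = (\<Sum>j<n. \<Sum>i<n. c * (K j i * sqdist j (n + i)))"
    by (rule sum.swap)
  also have "\<dots> = c * (\<Sum>i<n. \<Sum>j<n. K i j * sqdist i (n + j))"
    by (simp only: sum_distrib_left)
  finally have 4: "(\<Sum>i<n. \<Sum>j<n. w (n + i) j * sqdist (n + i) j)
      = c * (\<Sum>i<n. \<Sum>j<n. K i j * sqdist i (n + j))" .
  have "(\<Sum>p<2 * n. \<Sum>q<2 * n. w p q * sqdist p q)
    = (\<Sum>i<n. \<Sum>j<n. w i j * sqdist i j) + (\<Sum>i<n. \<Sum>j<n. w i (n + j) * sqdist i (n + j))
      + ((\<Sum>i<n. \<Sum>j<n. w (n + i) j * sqdist (n + i) j)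
        + (\<Sum>i<n. \<Sum>j<n. w (n + i) (n + j) * sqdist (n + i) (n + j)))"
    by (simp only: sum_lessThan_double sum.distrib)
  then show ?thesis
    unfolding energy_def 1 2 3 4 by simp
qed

section \<open>The two relaxations\<close>

lemma mult_mat_vec_eq_vec:
  assumes "Z \<in> carrier_mat N N"
  shows "Z *\<^sub>v vec N g = vec N (\<lambda>p. \<Sum>q<N. Z $$ (p, q) * g q)"
  using assms by (intro eq_vecI) (auto simp: scalar_prod_def atLeast0LessThan)

lemma scalar_prod_vec_vec:
  "scalar_prod (vec N f) (vec N g) = (\<Sum>p<N. f p * g p)"
  by (auto simp: scalar_prod_def atLeast0LessThan)

text \<open>Bridge from matrices to \<open>psd_kernel\<close>: the vectors of dimension
  \<open>N\<close> are exactly those of the form \<open>vec N f\<close>.\<close>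

lemma sym_psd_iff:
  "sym_psd N Z \<longleftrightarrow> Z \<in> carrier_mat N N \<and> (\<forall>p<N. \<forall>q<N. Z $$ (p, q) = Z $$ (q, p)) \<and>
     (\<forall>f. 0 \<le> (\<Sum>p<N. f p * (\<Sum>q<N. Z $$ (p, q) * f q)))"
proof (cases "Z \<in> carrier_mat N N")
  case True
  have "(\<forall>v \<in> carrier_vec N. 0 \<le> scalar_prod v (Z *\<^sub>v v))
    \<longleftrightarrow> (\<forall>f. 0 \<le> scalar_prod (vec N f) (Z *\<^sub>v vec N f))"
  proof (intro iffI ballI allI)
    fix v :: "real vec"
    assume "\<forall>f. 0 \<le> scalar_prod (vec N f) (Z *\<^sub>v vec N f)" "v \<in> carrier_vec N"
    moreover have "vec N (\<lambda>i. v $ i) = v"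
      using \<open>v \<in> carrier_vec N\<close> by auto
    ultimately show "0 \<le> scalar_prod v (Z *\<^sub>v v)" by metis
  qed auto
  moreover have "transpose_mat Z = Z \<longleftrightarrow> (\<forall>p<N. \<forall>q<N. Z $$ (p, q) = Z $$ (q, p))"
  proof
    assume *: "transpose_mat Z = Z"
    show "\<forall>p<N. \<forall>q<N. Z $$ (p, q) = Z $$ (q, p)"
    proof (intro allI impI)
      fix p q assume "p < N" "q < N"
      then have "transpose_mat Z $$ (p, q) = Z $$ (q, p)" using True by simp
      then show "Z $$ (p, q) = Z $$ (q, p)" by (simp only: *)
    qed
  next
    assume "\<forall>p<N. \<forall>q<N. Z $$ (p, q) = Z $$ (q, p)"
    then show "transpose_mat Z = Z" using True by (intro eq_matI) auto
  qed
  ultimately show ?thesis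
    using True by (simp add: sym_psd_def mult_mat_vec_eq_vec scalar_prod_vec_vec)
qed (simp add: sym_psd_def)

lemma frob_inner_eq:
  assumes "A \<in> carrier_mat N N" "Z \<in> carrier_mat N N"
  shows "frob_inner A Z = (\<Sum>p<N. \<Sum>q<N. A $$ (p, q) * Z $$ (p, q))"
proof -
  have "frob_inner A Z = (\<Sum>q<N. \<Sum>p<N. A $$ (p, q) * Z $$ (p, q))"
    using assms by (auto simp: frob_inner_def mat_trace_def scalar_prod_def atLeast0LessThan)
  then show ?thesis by (subst sum.swap)
qed

text \<open>Both relaxations in one: \<open>u = 1\<close> gives RatioCut-SDP, and the square roots of the degrees give
  NCut-SDP.\<close>

locale two_block_sdp =
  fixes n :: nat and w K :: "nat \<Rightarrow> nat \<Rightarrow> real" and c \<kappa> M R :: real and u :: "nat \<Rightarrow> real"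
  assumes n_gt_1: "1 < n"
    and K_sym: "\<lbrakk>i < n; j < n\<rbrakk> \<Longrightarrow> K i j = K j i"
    and K_nonneg: "\<lbrakk>i < n; j < n\<rbrakk> \<Longrightarrow> 0 \<le> K i j"
    and K_consecutive: "Suc e < n \<Longrightarrow> \<kappa> \<le> K e (Suc e)"
    and c_nonneg: "0 \<le> c"
    and w_blocks: "\<lbrakk>i < n; j < n\<rbrakk> \<Longrightarrow> w i j = K i j"
      "\<lbrakk>i < n; j < n\<rbrakk> \<Longrightarrow> w (n + i) (n + j) = K i j"
      "\<lbrakk>i < n; j < n\<rbrakk> \<Longrightarrow> w i (n + j) = c * K i j"
      "\<lbrakk>i < n; j < n\<rbrakk> \<Longrightarrow> w (n + i) j = c * K i j"
    and u_pos: "i < n \<Longrightarrow> 0 < u i"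
    and u_shift: "i < n \<Longrightarrow> u (n + i) = u i"
    and u_le: "i < n \<Longrightarrow> (u i)\<^sup>2 \<le> M"
    and degree_le: "i < n \<Longrightarrow> (\<Sum>j<n. K i j) \<le> R * (u i)\<^sup>2"
    and gap: "c * R * M * (real n * (real n - 1)) < \<kappa>"
begin

text \<open>With \<open>u = 1\<close> this is the unnormalized Laplacian. With the square roots of
  the degrees, the degree part becomes the identity and the matrix is the normalized
  Laplacian.\<close>

definition objective :: "real mat" where
  "objective = mat (2 * n) (2 * n)
     (\<lambda>(p, q). ((if p = q then \<Sum>r<2 * n. w p r else 0) - w p q) / (u p * u q))"

definition feasible :: "real mat set" where
  "feasible = {Z. sym_psd (2 * n) Z \<and> (\<forall>p < 2 * n. \<forall>q < 2 * n. 0 \<le> Z $$ (p, q)) \<and>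
     mat_trace Z = 2 \<and> Z *\<^sub>v vec (2 * n) u = vec (2 * n) u}"

definition total_mass :: real where "total_mass = (\<Sum>i<n. (u i)\<^sup>2)"

text \<open>A single denominator suffices because \<open>u_shift\<close> gives both clusters the
  same total mass.\<close>

definition optimum :: "real mat" where
  "optimum = mat (2 * n) (2 * n)
     (\<lambda>(p, q). if (p < n) = (q < n) then u p * u q / total_mass else 0)"

abbreviation rescaled :: "real mat \<Rightarrow> nat \<Rightarrow> nat \<Rightarrow> real" where
  "rescaled Z p q \<equiv> Z $$ (p, q) / (u p * u q)"

lemma index_cases:
  assumes "p < 2 * n"
  obtains "p < n" | i where "i < n" "p = n + i"
proof (cases "p < n")
  case False
  then show ?thesis using that(2)[of "p - n"] assms by simp
qed (rule that(1))

lemma u_gt_0: "p < 2 * n \<Longrightarrow> 0 < u p"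
  by (erule index_cases) (auto simp: u_pos u_shift)

lemma u_nonzero: "p < 2 * n \<Longrightarrow> u p \<noteq> 0"
  using u_gt_0 by fastforce

lemma w_sym:
  assumes "p < 2 * n" "q < 2 * n"
  shows "w p q = w q p"
  using assms by (elim index_cases) (use K_sym w_blocks in \<open>simp_all\<close>)

lemma total_mass_pos: "0 < total_mass"
  unfolding total_mass_def using n_gt_1 u_pos by (intro sum_pos) (auto simp: less_imp_neq[THEN not_sym])

lemma feasible_carrier: "Z \<in> feasible \<Longrightarrow> Z \<in> carrier_mat (2 * n) (2 * n)"
  by (simp add: feasible_def sym_psd_def)

text \<open>The division is a congruence by a positive diagonal matrix, so symmetry,
  semidefiniteness and nonnegativity survive. The fixed vector turns into row sums 1 for the masses
  \<open>(u i)\<^sup>2\<close>, and the trace acquires the same masses.\<close>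

lemma two_cluster_kernel_rescaled:
  assumes "Z \<in> feasible"
  shows "two_cluster_kernel n (rescaled Z) (\<lambda>i. (u i)\<^sup>2)"
proof
  have Z: "Z \<in> carrier_mat (2 * n) (2 * n)"
    "\<And>p q. \<lbrakk>p < 2 * n; q < 2 * n\<rbrakk> \<Longrightarrow> Z $$ (p, q) = Z $$ (q, p)"
    "\<And>f. 0 \<le> (\<Sum>p<2 * n. f p * (\<Sum>q<2 * n. Z $$ (p, q) * f q))"
    "\<And>p q. \<lbrakk>p < 2 * n; q < 2 * n\<rbrakk> \<Longrightarrow> 0 \<le> Z $$ (p, q)"
    "mat_trace Z = 2" "Z *\<^sub>v vec (2 * n) u = vec (2 * n) u"
    using assms by (simp_all add: feasible_def sym_psd_iff)
  show "rescaled Z p q = rescaled Z q p" if "p < 2 * n" "q < 2 * n" for p q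
    using Z(2)[OF that] by (simp add: mult.commute)
  show "0 \<le> (\<Sum>p<2 * n. f p * (\<Sum>q<2 * n. rescaled Z p q * f q))" for f
  proof -
    have "(\<Sum>p<2 * n. f p * (\<Sum>q<2 * n. rescaled Z p q * f q))
        = (\<Sum>p<2 * n. f p / u p * (\<Sum>q<2 * n. Z $$ (p, q) * (f q / u q)))"
      by (simp add: sum_distrib_left mult.commute)
    then show ?thesis using Z(3)[of "\<lambda>p. f p / u p"] by simp
  qed
  show "0 < n" using n_gt_1 by simp
  show "0 < (u i)\<^sup>2" if "i < n" for i
    using u_pos[OF that] by simp
  show "0 \<le> rescaled Z p q" if "p < 2 * n" "q < 2 * n" for p q
    using Z(4)[OF that] u_gt_0[OF that(1)] u_gt_0[OF that(2)] by simp
  show "(\<Sum>k<n. (u k)\<^sup>2 * rescaled Z p k) + (\<Sum>k<n. (u k)\<^sup>2 * rescaled Z p (n + k)) = 1"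
    if p: "p < 2 * n" for p
  proof -
    have row: "(\<Sum>q<2 * n. Z $$ (p, q) * u q) = u p"
      using arg_cong[OF Z(6), of "\<lambda>v. v $ p"] p by (simp add: mult_mat_vec_eq_vec[OF Z(1)])
    have "(\<Sum>k<n. (u k)\<^sup>2 * rescaled Z p k) = (\<Sum>k<n. Z $$ (p, k) * u k) / u p"
      unfolding sum_divide_distrib
      by (intro sum.cong refl) (auto simp: u_nonzero power2_eq_square)
    moreover have "(\<Sum>k<n. (u k)\<^sup>2 * rescaled Z p (n + k))
        = (\<Sum>k<n. Z $$ (p, n + k) * u (n + k)) / u p"
      unfolding sum_divide_distrib
      by (intro sum.cong refl) (auto simp: u_nonzero u_shift power2_eq_square)
    moreover have "(\<Sum>k<n. Z $$ (p, k) * u k) + (\<Sum>k<n. Z $$ (p, n + k) * u (n + k)) = u p"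
      using row by (simp only: sum_lessThan_double)
    ultimately show ?thesis
      using u_gt_0[OF p] by (simp flip: add_divide_distrib)
  qed
  have "(\<Sum>i<n. (u i)\<^sup>2 * rescaled Z i i) = (\<Sum>i<n. Z $$ (i, i))"
    by (intro sum.cong refl) (auto simp: u_nonzero power2_eq_square)
  moreover have "(\<Sum>i<n. (u i)\<^sup>2 * rescaled Z (n + i) (n + i)) = (\<Sum>i<n. Z $$ (n + i, n + i))"
    by (intro sum.cong refl) (auto simp: u_nonzero u_shift power2_eq_square)
  moreover have "mat_trace Z = (\<Sum>i<n. Z $$ (i, i)) + (\<Sum>i<n. Z $$ (n + i, n + i))"
    using Z(1) by (simp only: mat_trace_def carrier_matD sum_lessThan_double)
  ultimately show "(\<Sum>i<n. (u i)\<^sup>2 * rescaled Z i i)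
      + (\<Sum>i<n. (u i)\<^sup>2 * rescaled Z (n + i) (n + i)) = 2"
    using Z(5) by simp
qed

text \<open>The factors \<open>1 / (u p * u q)\<close> of the objective pass to \<open>Z\<close>,
  which leaves the plain Laplacian of \<open>w\<close> paired with the rescaled kernel.\<close>

lemma objective_eq_energy:
  assumes "Z \<in> feasible"
  shows "frob_inner objective Z = two_cluster_kernel.energy n (rescaled Z) K c"
proof -
  interpret two_cluster_kernel n "rescaled Z" "\<lambda>i. (u i)\<^sup>2"
    by (rule two_cluster_kernel_rescaled[OF assms])
  have "frob_inner objective Z = (\<Sum>p<2 * n. \<Sum>q<2 * n.
      ((if p = q then \<Sum>r<2 * n. w p r else 0) - w p q) * rescaled Z p q)"
    by (subst frob_inner_eq[OF _ feasible_carrier[OF assms]]) (simp_all add: objective_def)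
  also have "\<dots> = (\<Sum>p<2 * n. \<Sum>q<2 * n.
      (if p = q then (\<Sum>r<2 * n. w p r) * rescaled Z p p else 0) - w p q * rescaled Z p q)"
    by (intro sum.cong refl) (simp only: left_diff_distrib split: if_split, simp)
  also have "\<dots> = (\<Sum>p<2 * n. (\<Sum>r<2 * n. w p r) * rescaled Z p p)
      - (\<Sum>p<2 * n. \<Sum>q<2 * n. w p q * rescaled Z p q)"
    by (simp add: sum_subtractf)
  also have "\<dots> = energy K c"
    by (subst laplacian_form_eq[OF w_sym], assumption, assumption)
      (rule block_energy_eq; simp add: K_sym w_blocks)
  finally show ?thesis .
qed

section \<open>Optimal value and uniqueness of the minimizer\<close>

definition optimal_value :: real where
  "optimal_value = 2 * c * (\<Sum>i<n. \<Sum>j<n. K i j) / total_mass"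

lemma objective_ge:
  assumes "Z \<in> feasible"
  shows "optimal_value \<le> frob_inner objective Z"
proof -
  interpret two_cluster_kernel n "rescaled Z" "\<lambda>i. (u i)\<^sup>2"
    by (rule two_cluster_kernel_rescaled[OF assms])
  show ?thesis
    unfolding objective_eq_energy[OF assms] optimal_value_def total_mass_def mass_def[symmetric]
    by (rule energy_ge[OF K_sym K_nonneg K_consecutive c_nonneg u_le degree_le gap n_gt_1])
qed

lemma objective_le_imp_optimum:
  assumes "Z \<in> feasible" "frob_inner objective Z \<le> optimal_value"
  shows "Z = optimum"
proof -
  interpret two_cluster_kernel n "rescaled Z" "\<lambda>i. (u i)\<^sup>2"
    by (rule two_cluster_kernel_rescaled[OF assms(1)])
  have "leak = 0"
    by (rule leak_zero_if_minimal[OF K_sym K_nonneg K_consecutive c_nonneg u_le degree_le gap n_gt_1])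
      (use assms in \<open>simp_all add: objective_eq_energy optimal_value_def total_mass_def mass_def\<close>)
  note block = leak_zero_imp_block[OF this]
  have *: "rescaled Z p q = (if (p < n) = (q < n) then 1 / total_mass else 0)"
    if "p < 2 * n" "q < 2 * n" for p q
    using that by (elim index_cases) (use block in \<open>simp_all add: total_mass_def mass_def\<close>)
  have "Z $$ (p, q) = (if (p < n) = (q < n) then u p * u q / total_mass else 0)"
    if "p < 2 * n" "q < 2 * n" for p q
  proof -
    have "Z $$ (p, q) = rescaled Z p q * (u p * u q)"
      using that u_gt_0[of p] u_gt_0[of q] by simp
    then show ?thesis using * that by simp
  qed
  then show ?thesis
    using feasible_carrier[OF assms(1)] by (intro eq_matI) (auto simp: optimum_def)
qed

lemma optimum_feasible: "optimum \<in> feasible"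
proof -
  have carrier: "optimum \<in> carrier_mat (2 * n) (2 * n)" by (simp add: optimum_def)
  have row1: "(\<Sum>q<2 * n. optimum $$ (i, q) * f q) = u i / total_mass * (\<Sum>k<n. u k * f k)"
    and row2: "(\<Sum>q<2 * n. optimum $$ (n + i, q) * f q) = u i / total_mass * (\<Sum>k<n. u k * f (n + k))"
    if "i < n" for i f
    using that unfolding sum_lessThan_double
    by (simp_all add: optimum_def u_shift sum_distrib_left mult.assoc)
  \<comment> \<open>The quadratic form is a sum of two squares over \<open>total_mass\<close>, one
    for each cluster.\<close>
  have psd: "0 \<le> (\<Sum>p<2 * n. f p * (\<Sum>q<2 * n. optimum $$ (p, q) * f q))" for f
  proof -
    define S1 S2 where "S1 = (\<Sum>k<n. u k * f k)" and "S2 = (\<Sum>k<n. u k * f (n + k))"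
    have "(\<Sum>p<2 * n. f p * (\<Sum>q<2 * n. optimum $$ (p, q) * f q))
      = (\<Sum>i<n. f i * (u i / total_mass * S1)) + (\<Sum>i<n. f (n + i) * (u i / total_mass * S2))"
      unfolding sum_lessThan_double[of "\<lambda>p. f p * (\<Sum>q<2 * n. optimum $$ (p, q) * f q)"]
      by (simp add: row1 row2 S1_def S2_def)
    also have "\<dots> = S1 / total_mass * (\<Sum>i<n. u i * f i) + S2 / total_mass * (\<Sum>i<n. u i * f (n + i))"
      by (simp add: sum_distrib_left mult_ac)
    also have "\<dots> = S1\<^sup>2 / total_mass + S2\<^sup>2 / total_mass"
      by (simp add: S1_def S2_def power2_eq_square)
    finally have "(\<Sum>p<2 * n. f p * (\<Sum>q<2 * n. optimum $$ (p, q) * f q))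
      = S1\<^sup>2 / total_mass + S2\<^sup>2 / total_mass" .
    then show ?thesis using total_mass_pos by simp
  qed
  have "optimum $$ (p, q) = optimum $$ (q, p)" "0 \<le> optimum $$ (p, q)"
    if "p < 2 * n" "q < 2 * n" for p q
    using that u_gt_0[of p] u_gt_0[of q] total_mass_pos by (auto simp: optimum_def)
  moreover have "mat_trace optimum = 2"
  proof -
    have "mat_trace optimum = (\<Sum>p<2 * n. (u p)\<^sup>2 / total_mass)"
      by (simp add: mat_trace_def optimum_def power2_eq_square)
    also have "\<dots> = 2 * (\<Sum>i<n. (u i)\<^sup>2 / total_mass)"
      unfolding sum_lessThan_double by (simp add: u_shift)
    also have "\<dots> = 2"
      using total_mass_pos by (simp add: total_mass_def flip: sum_divide_distrib)
    finally show ?thesis .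
  qed
  moreover have "(\<Sum>q<2 * n. optimum $$ (p, q) * u q) = u p" if "p < 2 * n" for p
  proof -
    have *: "(\<Sum>k<n. u k * u k) = total_mass" "(\<Sum>k<n. u k * u (n + k)) = total_mass"
      by (simp_all add: total_mass_def power2_eq_square u_shift)
    show ?thesis
      using that by (elim index_cases) (use total_mass_pos in \<open>simp_all add: row1 row2 * u_shift\<close>)
  qed
  ultimately show ?thesis
    using carrier psd
    by (auto simp: feasible_def sym_psd_iff mult_mat_vec_eq_vec intro!: eq_vecI)
qed

text \<open>At the optimum the points of each cluster coincide and the clusters lie at squared
  distance \<open>2 / total_mass\<close>, so only the cross term of the energy remains.\<close>

lemma objective_optimum: "frob_inner objective optimum = optimal_value"
proof -
  interpret two_cluster_kernel n "rescaled optimum" "\<lambda>i. (u i)\<^sup>2"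
    by (rule two_cluster_kernel_rescaled[OF optimum_feasible])
  have r: "rescaled optimum p q = (if (p < n) = (q < n) then 1 / total_mass else 0)"
    if "p < 2 * n" "q < 2 * n" for p q
    using that u_gt_0[of p] u_gt_0[of q] by (simp add: optimum_def)
  have "sqdist i j = 0" "sqdist (n + i) (n + j) = 0" "sqdist i (n + j) = 2 / total_mass"
    if "i < n" "j < n" for i j
    using that by (simp_all add: sqdist_def r)
  then show ?thesis
    by (simp add: objective_eq_energy[OF optimum_feasible] energy_def optimal_value_def
        sum_distrib_left sum_divide_distrib mult_ac)
qed

theorem unique_minimizer:
  "{Z. is_arg_min (frob_inner objective) (\<lambda>Z. Z \<in> feasible) Z} = {optimum}"
proof (intro equalityI subsetI)
  fix Z assume "Z \<in> {Z. is_arg_min (frob_inner objective) (\<lambda>Z. Z \<in> feasible) Z}"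
  then have "Z \<in> feasible" "frob_inner objective Z \<le> optimal_value"
    using optimum_feasible objective_optimum by (auto simp: is_arg_min_linorder)
  then show "Z \<in> {optimum}" using objective_le_imp_optimum by blast
next
  fix Z assume "Z \<in> {optimum}"
  then show "Z \<in> {Z. is_arg_min (frob_inner objective) (\<lambda>Z. Z \<in> feasible) Z}"
    using optimum_feasible objective_optimum objective_ge by (auto simp: is_arg_min_linorder)
qed

end

section \<open>Entries of the Laplacians and degree matrices\<close>

lemma degree_vec_mat:
  "degree_vec (mat N N (\<lambda>(p, q). w p q)) = vec N (\<lambda>p. \<Sum>q<N. w p q)"
  by (intro eq_vecI) (auto simp: degree_vec_def ones_vec_def scalar_prod_def atLeast0LessThan)

lemma laplacian_mat:
  "laplacian (mat N N (\<lambda>(p, q). w p q))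
    = mat N N (\<lambda>(p, q). (if p = q then \<Sum>r<N. w p r else 0) - w p q)"
  by (intro eq_matI) (auto simp: laplacian_def degree_mat_def mat_diag_def degree_vec_mat)

lemma sym_laplacian_mat:
  "sym_laplacian (mat N N (\<lambda>(p, q). w p q))
    = mat N N (\<lambda>(p, q). (if p = q then 1 else 0)
        - w p q / (sqrt (\<Sum>r<N. w p r) * sqrt (\<Sum>r<N. w q r)))"
proof -
  let ?d = "\<lambda>p. 1 / sqrt (\<Sum>r<N. w p r)" and ?W = "mat N N (\<lambda>(p, q). w p q)"
  have "degree_inv_sqrt_mat ?W = mat_diag N ?d"
    by (intro eq_matI) (auto simp: degree_inv_sqrt_mat_def mat_diag_def degree_vec_mat)
  moreover have "mat_diag N ?d * ?W * mat_diag N ?d = mat N N (\<lambda>(p, q). ?d p * w p q * ?d q)"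
    by (subst mat_diag_mult_left[of _ N N], simp, subst mat_diag_mult_right[of _ N N], simp)
      (intro eq_matI, auto)
  ultimately show ?thesis
    by (intro eq_matI) (auto simp: sym_laplacian_def)
qed

lemma mat_diag_mult_vec:
  "mat_diag N d *\<^sub>v vec N f = vec N (\<lambda>p. d p * f p)" for d f :: "nat \<Rightarrow> real"
proof (rule eq_vecI)
  fix i assume "i < dim_vec (vec N (\<lambda>p. d p * f p))"
  then have i: "i < N" by simp
  have "(mat_diag N d *\<^sub>v vec N f) $ i = (\<Sum>q<N. mat_diag N d $$ (i, q) * f q)"
    using i by (simp add: mult_mat_vec_eq_vec[of _ N])
  also have "\<dots> = (\<Sum>q<N. if q = i then d i * f i else 0)"
    using i by (intro sum.cong refl) (auto simp: mat_diag_def)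
  finally show "(mat_diag N d *\<^sub>v vec N f) $ i = vec N (\<lambda>p. d p * f p) $ i"
    using i by simp
qed (simp add: mat_diag_def)

lemma degree_sqrt_mat_mult_vec:
  "degree_sqrt_mat (mat N N (\<lambda>(p, q). w p q)) *\<^sub>v vec N f
    = vec N (\<lambda>p. sqrt (\<Sum>r<N. w p r) * f p)"
proof -
  have "degree_sqrt_mat (mat N N (\<lambda>(p, q). w p q)) = mat_diag N (\<lambda>p. sqrt (\<Sum>r<N. w p r))"
    by (intro eq_matI) (auto simp: degree_sqrt_mat_def mat_diag_def degree_vec_mat)
  then show ?thesis by (simp add: mat_diag_mult_vec)
qed

lemma indicator_vec_degree_mat:
  assumes "S \<subseteq> {..<N}"
  shows "scalar_prod (indicator_vec N S) (degree_mat (mat N N (\<lambda>(p, q). w p q)) *\<^sub>v indicator_vec N S)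
    = (\<Sum>p\<in>S. \<Sum>r<N. w p r)"
proof -
  have "degree_mat (mat N N (\<lambda>(p, q). w p q)) = mat_diag N (\<lambda>p. \<Sum>r<N. w p r)"
    by (intro eq_matI) (auto simp: degree_mat_def mat_diag_def degree_vec_mat)
  then have "scalar_prod (indicator_vec N S) (degree_mat (mat N N (\<lambda>(p, q). w p q)) *\<^sub>v indicator_vec N S)
      = (\<Sum>p<N. indicator S p * ((\<Sum>r<N. w p r) * indicator S p))"
    by (simp only: indicator_vec_def scalar_prod_vec_vec mat_diag_mult_vec)
  also have "\<dots> = (\<Sum>p\<in>{..<N}. if p \<in> S then \<Sum>r<N. w p r else 0)"
    by (intro sum.cong refl) (simp add: indicator_def)
  also have "\<dots> = (\<Sum>p\<in>S. \<Sum>r<N. w p r)"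
    using assms by (simp add: sum.If_cases Int_absorb1)
  finally show ?thesis .
qed

section \<open>RatioCut-SDP and NCut-SDP as instances of the common program\<close>

context two_block_sdp
begin

abbreviation weights :: "real mat" where
  "weights \<equiv> mat (2 * n) (2 * n) (\<lambda>(p, q). w p q)"

lemma ratiocut_exact:
  assumes u: "u = (\<lambda>_. 1)" and \<Gamma>: "\<Gamma> 1 = {0..<n}" "\<Gamma> 2 = {n..<2 * n}"
  shows "ratiocut_sdp_exact_recovery weights 2 \<Gamma>"
proof -
  have "laplacian weights = objective"
    unfolding laplacian_mat objective_def by (simp add: u)
  moreover have "ratiocut_feasible weights 2 = feasible"
    unfolding ratiocut_feasible_def feasible_def by (simp add: ones_vec_def u)
  moreover have "ratiocut_partition_mat weights 2 \<Gamma> = optimum"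
  proof -
    have "{1..2::nat} = {1, 2}" by auto
    then show ?thesis
      unfolding ratiocut_partition_mat_def optimum_def total_mass_def
      by (intro eq_matI) (auto simp: Let_def indicator_vec_def \<Gamma>[unfolded One_nat_def] u indicator_def)
  qed
  ultimately show ?thesis
    using unique_minimizer by (simp add: ratiocut_sdp_exact_recovery_def)
qed

lemma ncut_exact:
  assumes u: "\<And>p. u p = sqrt (\<Sum>q<2 * n. w p q)"
    and \<Gamma>: "\<Gamma> 1 = {0..<n}" "\<Gamma> 2 = {n..<2 * n}"
  shows "ncut_sdp_exact_recovery weights 2 \<Gamma>"
proof -
  \<comment> \<open>\<open>sqrt\<close> is also defined on negative numbers, so positivity of the
    degree is read off from \<open>u_gt_0\<close>.\<close>
  have u2: "(\<Sum>q<2 * n. w p q) = (u p)\<^sup>2" if "p < 2 * n" for p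
    using u_gt_0[OF that] by (simp add: u)
  have "sym_laplacian weights = objective"
    unfolding sym_laplacian_mat u[symmetric]
    by (intro eq_matI)
      (auto simp: objective_def u2 u_nonzero diff_divide_distrib power2_eq_square)
  moreover have "degree_sqrt_mat weights *\<^sub>v ones_vec (2 * n) = vec (2 * n) u"
    by (simp add: ones_vec_def degree_sqrt_mat_mult_vec flip: u)
  then have "ncut_feasible weights 2 = feasible"
    by (simp add: ncut_feasible_def feasible_def)
  moreover have "ncut_partition_mat weights 2 \<Gamma> = optimum"
  proof -
    have *: "degree_sqrt_mat weights *\<^sub>v indicator_vec (2 * n) S = vec (2 * n) (\<lambda>p. u p * indicator S p)"
      for S
      by (simp add: indicator_vec_def degree_sqrt_mat_mult_vec flip: u)
    \<comment> \<open>The volume of either cluster, the denominator in the partition matrix, is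
      \<open>total_mass\<close>.\<close>
    have "(\<Sum>p = 0..<n. \<Sum>q<2 * n. w p q) = total_mass"
      unfolding total_mass_def atLeast0LessThan by (intro sum.cong refl) (simp add: u2)
    then have 1: "scalar_prod (indicator_vec (2 * n) {0..<n})
        (degree_mat weights *\<^sub>v indicator_vec (2 * n) {0..<n}) = total_mass"
      by (subst indicator_vec_degree_mat) auto
    have "(\<Sum>p = n..<2 * n. \<Sum>q<2 * n. w p q) = (\<Sum>i = 0..<n. \<Sum>q<2 * n. w (i + n) q)"
      using sum.shift_bounds_nat_ivl[of "\<lambda>p. \<Sum>q<2 * n. w p q" 0 n n] by (simp add: mult_2)
    also have "\<dots> = total_mass"
      unfolding total_mass_def atLeast0LessThan
      by (intro sum.cong refl) (simp add: u2 u_shift add.commute[of _ n])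
    finally have 2: "scalar_prod (indicator_vec (2 * n) {n..<2 * n})
        (degree_mat weights *\<^sub>v indicator_vec (2 * n) {n..<2 * n}) = total_mass"
      by (subst indicator_vec_degree_mat) auto
    have "{1..2::nat} = {1, 2}" by auto
    then show ?thesis
      by (intro eq_matI)
        (auto simp: ncut_partition_mat_def optimum_def Let_def * 1 2 \<Gamma>[unfolded One_nat_def])
  qed
  ultimately show ?thesis
    using unique_minimizer by (simp add: ncut_sdp_exact_recovery_def)
qed

end

section \<open>Points on two parallel lines\<close>

lemma heat_kernel_Pair:
  fixes a b a' b' :: real
  shows "heat_kernel \<sigma> (a, b) (a', b')
    = exp (- (a - a')\<^sup>2 / (2 * \<sigma>\<^sup>2)) * exp (- (b - b')\<^sup>2 / (2 * \<sigma>\<^sup>2))"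
  unfolding exp_add[symmetric] by (simp add: heat_kernel_def norm_Pair diff_divide_distrib)

text \<open>\<open>across_le\<close> is the separation condition in the form c n^3 <= \<kappa>, with
  \<kappa> the weight of neighbours on a line; \<gamma> no longer appears.\<close>

locale parallel_lines =
  fixes n :: nat and \<Delta> \<sigma> :: real
  assumes n_gt_1: "1 < n" and \<Delta>_pos: "0 < \<Delta>"
    and across_le: "exp (- \<Delta>\<^sup>2 / (2 * \<sigma>\<^sup>2)) * real n ^ 3
      \<le> exp (- 1 / (2 * \<sigma>\<^sup>2 * (real n - 1)\<^sup>2))"
begin

definition K :: "nat \<Rightarrow> nat \<Rightarrow> real" where
  "K i j = exp (- (real i - real j)\<^sup>2 / (2 * \<sigma>\<^sup>2 * (real n - 1)\<^sup>2))"

definition c :: real where "c = exp (- \<Delta>\<^sup>2 / (2 * \<sigma>\<^sup>2))"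

definition w :: "nat \<Rightarrow> nat \<Rightarrow> real" where
  "w p q = heat_kernel \<sigma> (data_point \<Delta> n p) (data_point \<Delta> n q)"

definition degree :: "nat \<Rightarrow> real" where "degree p = (\<Sum>q<2 * n. w p q)"

lemma c_pos: "0 < c"
  by (simp add: c_def)

lemma K_pos: "0 < K i j"
  by (simp add: K_def)

lemma K_sym: "K i j = K j i"
  by (simp add: K_def power2_commute)

lemma along_line_kernel:
  "exp (- ((real i - 1) / (real n - 1) - (real j - 1) / (real n - 1))\<^sup>2 / (2 * \<sigma>\<^sup>2)) = K i j"
  by (simp add: K_def power_divide flip: diff_divide_distrib)

text \<open>The heat kernel is a product over the two coordinates; the horizontal factor is 1 within
  a line and \<open>c\<close> across.\<close>

lemma w_blocks:
  assumes "i < n" "j < n"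
  shows "w i j = K i j" "w (n + i) (n + j) = K i j" "w i (n + j) = c * K i j" "w (n + i) j = c * K i j"
  using along_line_kernel[of "i + 1" "j + 1"] assms
  by (simp_all add: w_def data_point_def line_point_def heat_kernel_Pair c_def K_def)

lemma sum_K_le: "(\<Sum>j<n. K i j) \<le> real n"
proof -
  have "(\<Sum>j<n. K i j) \<le> (\<Sum>j<n. 1)"
    by (intro sum_mono) (simp add: K_def)
  then show ?thesis by simp
qed

lemma sum_K_pos: "0 < (\<Sum>j<n. K i j)"
  using n_gt_1 K_pos by (intro sum_pos) auto

lemma degree_eq:
  assumes "i < n"
  shows "degree i = (1 + c) * (\<Sum>j<n. K i j)" "degree (n + i) = (1 + c) * (\<Sum>j<n. K i j)"
  using assms
  by (simp_all add: degree_def sum_lessThan_double w_blocks distrib_right flip: sum_distrib_left)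

text \<open>Strictness, as \<open>gap\<close> demands, comes from n - 1 < n.\<close>

lemma across_less: "c * (real n * (real n * (real n - 1))) < K e (Suc e)"
proof -
  have "c * (real n * (real n * (real n - 1))) < c * real n ^ 3"
    using n_gt_1 c_pos by (simp add: power3_eq_cube)
  also have "\<dots> \<le> K e (Suc e)"
    using across_le by (simp add: c_def K_def)
  finally show ?thesis .
qed

text \<open>All masses are 1, and \<open>R\<close> is n because the entries of \<open>K\<close> are
  at most 1.\<close>

sublocale ratiocut: two_block_sdp n w K c "K 0 1" 1 "real n" "\<lambda>_. 1"
proof
  show "c * real n * 1 * (real n * (real n - 1)) < K 0 1"
    using across_less[of 0] by (simp add: mult.assoc)
qed (use n_gt_1 K_sym K_pos c_pos sum_K_le w_blocks in \<open>simp_all add: less_imp_le, simp_all add: K_def\<close>)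

text \<open>Degrees are \<open>1 + c\<close> times the row sums of \<open>K\<close>, which dictates
  \<open>R\<close> and \<open>M\<close>. Their product is n as for RatioCut, so the same gap
  condition serves both relaxations.\<close>

sublocale ncut: two_block_sdp n w K c "K 0 1" "(1 + c) * real n" "1 / (1 + c)" "\<lambda>p. sqrt (degree p)"
proof
  have c1: "0 < 1 + c" using c_pos by simp
  show "c * (1 / (1 + c)) * ((1 + c) * real n) * (real n * (real n - 1)) < K 0 1"
    using across_less[of 0] c1 by (simp add: mult.assoc)
  have sq: "(sqrt (degree i))\<^sup>2 = (1 + c) * (\<Sum>j<n. K i j)" if "i < n" for i
    using c1 sum_K_pos[of i] by (simp add: degree_eq[OF that])
  show "(sqrt (degree i))\<^sup>2 \<le> (1 + c) * real n" if "i < n" for i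
    unfolding sq[OF that] using c1 sum_K_le by (intro mult_left_mono) auto
  show "(\<Sum>j<n. K i j) \<le> 1 / (1 + c) * (sqrt (degree i))\<^sup>2" if "i < n" for i
    unfolding sq[OF that] using c1 by simp
  show "0 < sqrt (degree i)" if "i < n" for i
    using c1 sum_K_pos[of i] by (simp add: degree_eq[OF that])
  show "sqrt (degree (n + i)) = sqrt (degree i)" if "i < n" for i
    by (simp add: degree_eq[OF that])
qed (use n_gt_1 K_sym K_pos c_pos w_blocks in \<open>simp_all add: less_imp_le, simp_all add: K_def\<close>)

text \<open>Clusters are defined by location; \<Delta> > 0 keeps a point of one line from being
  counted on the other.\<close>

lemma line_cluster_eq: "line_cluster \<Delta> n 1 = {0..<n}" "line_cluster \<Delta> n 2 = {n..<2 * n}"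
proof -
  have mem: "data_point \<Delta> n p \<in> line_point \<Delta> n 1 ` {1..n} \<longleftrightarrow> p < n"
    "data_point \<Delta> n p \<in> line_point \<Delta> n 2 ` {1..n} \<longleftrightarrow> n \<le> p" if "p < 2 * n" for p
  proof -
    have 1: "data_point \<Delta> n p = line_point \<Delta> n 1 (p + 1)" "p + 1 \<in> {1..n}" if "p < n"
      using that by (auto simp: data_point_def)
    have 2: "data_point \<Delta> n p = line_point \<Delta> n 2 (p - n + 1)" "p - n + 1 \<in> {1..n}" if "n \<le> p"
      using that \<open>p < 2 * n\<close> by (auto simp: data_point_def)
    have ne: "line_point \<Delta> n 1 i \<noteq> line_point \<Delta> n 2 j" for i j
      using \<Delta>_pos by (simp add: line_point_def)
    show "data_point \<Delta> n p \<in> line_point \<Delta> n 1 ` {1..n} \<longleftrightarrow> p < n"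
      using 1 2 ne by (metis imageE imageI not_less)
    show "data_point \<Delta> n p \<in> line_point \<Delta> n 2 ` {1..n} \<longleftrightarrow> n \<le> p"
      using 1 2 ne by (metis imageE imageI not_less)
  qed
  have "line_cluster \<Delta> n 1 = {p. p < 2 * n \<and> p < n}"
    "line_cluster \<Delta> n 2 = {p. p < 2 * n \<and> n \<le> p}"
    unfolding line_cluster_def by (rule Collect_cong, rule conj_cong[OF refl], rule mem, assumption)+
  moreover have "{p. p < 2 * n \<and> p < n} = {0..<n}" "{p. p < 2 * n \<and> n \<le> p} = {n..<2 * n}"
    by auto
  ultimately show "line_cluster \<Delta> n 1 = {0..<n}" "line_cluster \<Delta> n 2 = {n..<2 * n}"
    by (simp_all only:)
qed

lemma exact_recovery:
  "ratiocut_sdp_exact_recovery (lines_weight_mat \<sigma> \<Delta> n) 2 (line_cluster \<Delta> n)"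
  "ncut_sdp_exact_recovery (lines_weight_mat \<sigma> \<Delta> n) 2 (line_cluster \<Delta> n)"
proof -
  have "lines_weight_mat \<sigma> \<Delta> n = mat (2 * n) (2 * n) (\<lambda>(p, q). w p q)"
    by (simp add: lines_weight_mat_def weight_mat_def w_def)
  then show "ratiocut_sdp_exact_recovery (lines_weight_mat \<sigma> \<Delta> n) 2 (line_cluster \<Delta> n)"
    "ncut_sdp_exact_recovery (lines_weight_mat \<sigma> \<Delta> n) 2 (line_cluster \<Delta> n)"
    using ratiocut.ratiocut_exact[OF refl line_cluster_eq]
      ncut.ncut_exact[OF _ line_cluster_eq] by (simp_all add: degree_def)
qed

end

section \<open>The separation condition in terms of the weights\<close>

theorem theorem4p2:
  fixes n :: nat and \<Delta> \<gamma> \<sigma> :: real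
  assumes "\<Delta> > 0" and "\<gamma> > 0" and "\<sigma> > 0"
    and "\<sigma>\<^sup>2 = \<gamma> / ((real n - 1)\<^sup>2 * ln (real n / pi))"
    and "\<Delta> \<ge> 1 / (real n - 1) * sqrt (1 + 6 * \<gamma> * ln (real n) / ln (real n / pi))"
  shows "ratiocut_sdp_exact_recovery (lines_weight_mat \<sigma> \<Delta> n) 2 (line_cluster \<Delta> n)
       \<and> ncut_sdp_exact_recovery (lines_weight_mat \<sigma> \<Delta> n) 2 (line_cluster \<Delta> n)"
proof -
  define l L a where "l = ln (real n / pi)" and "L = ln (real n)" and "a = real n - 1"
  have \<sigma>2: "\<sigma>\<^sup>2 = \<gamma> / (a\<^sup>2 * l)" and \<Delta>: "1 / a * sqrt (1 + 6 * \<gamma> * L / l) \<le> \<Delta>"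
    using assms by (simp_all add: l_def L_def a_def)
  \<comment> \<open>The bandwidth equation with \<sigma> > 0 and \<gamma> > 0 forces log(n / pi) to
    be positive, and from this n > pi is derived.\<close>
  have "0 < \<gamma> / (a\<^sup>2 * l)" using \<open>\<sigma> > 0\<close> by (simp flip: \<sigma>2)
  then have l_pos: "0 < l"
    using \<open>\<gamma> > 0\<close> by (auto simp: zero_less_divide_iff zero_less_mult_iff)
  have "pi < real n"
  proof (rule ccontr)
    assume "\<not> pi < real n"
    then have "real n / pi \<le> 1" by simp
    \<comment> \<open>For n = 0 the logarithm takes the default value
      \<open>ln 0 = 0\<close>.\<close>
    then have "l \<le> 0" by (cases "n = 0") (simp_all add: l_def)
    then show False using l_pos by simp
  qed
  then have "2 < real n" using pi_ge_two by linarith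
  then have n: "1 < n" and a_pos: "0 < a" and L_pos: "0 < L"
    by (simp_all add: a_def L_def)
  have "(1 / a * sqrt (1 + 6 * \<gamma> * L / l))\<^sup>2 \<le> \<Delta>\<^sup>2"
    using \<Delta> a_pos \<open>\<gamma> > 0\<close> L_pos l_pos by (intro power_mono) auto
  then have "(1 + 6 * \<gamma> * L / l) / a\<^sup>2 \<le> \<Delta>\<^sup>2"
    using \<open>\<gamma> > 0\<close> L_pos l_pos by (simp add: power_mult_distrib power_divide)
  then have "(1 + 6 * \<gamma> * L / l) / a\<^sup>2 / (2 * \<sigma>\<^sup>2) \<le> \<Delta>\<^sup>2 / (2 * \<sigma>\<^sup>2)"
    by (intro divide_right_mono) auto
  \<comment> \<open>The 6 in the separation condition is halved by the 2 in the kernel and leaves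
    \<open>3 * L\<close>, whose exponential is the factor n^3.\<close>
  also have "(1 + 6 * \<gamma> * L / l) / a\<^sup>2 / (2 * \<sigma>\<^sup>2) = 1 / (2 * \<sigma>\<^sup>2 * a\<^sup>2) + 3 * L"
    using \<open>\<gamma> > 0\<close> l_pos a_pos by (simp add: \<sigma>2 field_simps)
  finally have "- \<Delta>\<^sup>2 / (2 * \<sigma>\<^sup>2) + 3 * L \<le> - 1 / (2 * \<sigma>\<^sup>2 * a\<^sup>2)"
    by simp
  then have "exp (- \<Delta>\<^sup>2 / (2 * \<sigma>\<^sup>2)) * exp (3 * L) \<le> exp (- 1 / (2 * \<sigma>\<^sup>2 * a\<^sup>2))"
    by (simp flip: exp_add)
  moreover have "exp (3 * L) = real n ^ 3"
    using n by (simp add: L_def exp_of_nat_mult[of 3, simplified])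
  ultimately interpret parallel_lines n \<Delta> \<sigma>
    using n \<open>\<Delta> > 0\<close> by unfold_locales (simp_all add: a_def)
  show ?thesis using exact_recovery by blast
qed

end
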